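(* Let $p$ be a prime with $p \equiv 1 \pmod 3$. Consider the following algorithm. (1) Form the list, in ascending order of Mahler measure, of all irreducible, non-cyclotomic cubic polynomials in $\mathbb{Z}[x]$ with Mahler measure at most $8.5$; let $f$ be the first polynomial on the list. (2) Write $f(x) = ax^3+bx^2+cx+d$, put it in depressed form $g(x) = x^3+Ax+B$ with $A = \frac{3ac-b^2}{3a^2}$, $B = \frac{27a^2d - 9abc + 2b^3}{27a^3}$, and let $\Delta = B^2 + 4A^3/27$. (3) If $\Delta$ is not a square in $\mathbb{Q}_p$, return to step (2) with the next polynomial on the list. (4) If $A = 0$ let $C = -B$, and otherwise let $C$ be a square root of $\Delta$ in $\mathbb{Q}_p$. If $\frac{-B+C}{2}$ is not a cube in $\mathbb{Q}_p$, return to step (2) with the next polynomial on the list; otherwise terminate and output $\frac{1}{3}\log M(f)$. Then this algorithm terminates, and its output equals $\tau_{3,p}$.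
   Context: For a polynomial $f(x) = a\prod_{i}(x-\alpha_i) \in \mathbb{C}[x]$, the Mahler measure is $M(f) = |a|\prod_i \max(1,|\alpha_i|)$. For an algebraic number $\alpha$ of degree $d$ with (primitive) minimal polynomial $f_\alpha \in \mathbb{Z}[x]$, its logarithmic Weil height is $h(\alpha) = \frac{1}{d}\log M(f_\alpha)$. An algebraic number is totally $p$-adic if its minimal polynomial splits completely over $\mathbb{Q}_p$. $\tau_{3,p}$ denotes the smallest height attained by a totally $p$-adic algebraic number of degree $3$ that is nonzero and not a root of unity. *)

theory Defs
  imports
    "HOL-Algebra.QuotRing"
    "HOL-Algebra.Polynomial_Divisibility"
    "HOL-Number_Theory.Cong"
    "Berlekamp_Zassenhaus.Mahler_Measure"
begin

section \<open>The field of p-adic numbers\<close>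

definition padic_abs :: "nat \<Rightarrow> rat \<Rightarrow> real" where
  "padic_abs p q =
     (if q = 0 then 0
      else real p powi (int (multiplicity (int p) (snd (quotient_of q)))
                        - int (multiplicity (int p) (fst (quotient_of q)))))"

definition padic_Cauchy :: "nat \<Rightarrow> (nat \<Rightarrow> rat) \<Rightarrow> bool" where
  "padic_Cauchy p x \<longleftrightarrow> (\<forall>e>0. \<exists>N. \<forall>m\<ge>N. \<forall>n\<ge>N. padic_abs p (x m - x n) < e)"

definition padic_Cauchy_ring :: "nat \<Rightarrow> (nat \<Rightarrow> rat) ring" where
  "padic_Cauchy_ring p =
     \<lparr> carrier = {x. padic_Cauchy p x},
       mult = (\<lambda>x y n. x n * y n),
       one = (\<lambda>n. 1),
       zero = (\<lambda>n. 0),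
       add = (\<lambda>x y n. x n + y n) \<rparr>"

definition padic_null :: "nat \<Rightarrow> (nat \<Rightarrow> rat) set" where
  "padic_null p = {x. (\<lambda>n. padic_abs p (x n)) \<longlonglongrightarrow> 0}"

text \<open>The completion of the rationals with respect to \<^const>\<open>padic_abs\<close>; this is
  \<open>\<rat>\<^sub>p\<close> if \<open>p\<close> is prime.\<close>

definition Qp :: "nat \<Rightarrow> (nat \<Rightarrow> rat) set ring" where
  "Qp p = padic_Cauchy_ring p Quot padic_null p"

definition Qp_of_rat :: "nat \<Rightarrow> rat \<Rightarrow> (nat \<Rightarrow> rat) set" where
  "Qp_of_rat p q = padic_null p +>\<^bsub>padic_Cauchy_ring p\<^esub> (\<lambda>n. q)"

definition is_power_in :: "('a, 'b) ring_scheme \<Rightarrow> nat \<Rightarrow> 'a \<Rightarrow> bool" where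
  "is_power_in R n x \<longleftrightarrow> (\<exists>y\<in>carrier R. y [^]\<^bsub>R\<^esub> n = x)"

text \<open>HOL-Algebra represents a univariate polynomial by the list of its coefficients,
  leading coefficient first, hence the \<^const>\<open>rev\<close>.\<close>

definition splits_over_Qp :: "nat \<Rightarrow> int poly \<Rightarrow> bool" where
  "splits_over_Qp p f \<longleftrightarrow>
     ring.splitted (Qp p) (map (\<lambda>c. Qp_of_rat p (of_int c)) (rev (coeffs f)))"


section \<open>Algebraic numbers, heights and totally p-adic numbers\<close>

text \<open>The minimal polynomial in \<open>\<int>[x]\<close>: primitive, with the sign normalised by a positive
  leading coefficient. It is meaningful only for algebraic numbers.\<close>

definition min_int_poly :: "complex \<Rightarrow> int poly" where
  "min_int_poly \<alpha> = (THE f. content f = 1 \<and> lead_coeff f > 0 \<and> poly (map_poly of_int f) \<alpha> = 0 \<and>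
     (\<forall>g. g \<noteq> 0 \<and> poly (map_poly of_int g) \<alpha> = 0 \<longrightarrow> Polynomial.degree f \<le> Polynomial.degree g))"

definition alg_degree :: "complex \<Rightarrow> nat" where
  "alg_degree \<alpha> = Polynomial.degree (min_int_poly \<alpha>)"

definition weil_height :: "complex \<Rightarrow> real" where
  "weil_height \<alpha> = 1 / real (alg_degree \<alpha>) * ln (mahler_measure (min_int_poly \<alpha>))"

definition totally_padic :: "nat \<Rightarrow> complex \<Rightarrow> bool" where
  "totally_padic p \<alpha> \<longleftrightarrow> algebraic \<alpha> \<and> splits_over_Qp p (min_int_poly \<alpha>)"

definition root_of_unity :: "complex \<Rightarrow> bool" where
  "root_of_unity \<alpha> \<longleftrightarrow> (\<exists>n>0. \<alpha> ^ n = 1)"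

definition tau :: "nat \<Rightarrow> nat \<Rightarrow> real" where
  "tau d p = (LEAST h. h \<in> {weil_height \<alpha> | \<alpha>.
     totally_padic p \<alpha> \<and> alg_degree \<alpha> = d \<and> \<alpha> \<noteq> 0 \<and> \<not> root_of_unity \<alpha>})"


section \<open>The algorithm\<close>

definition cyclotomic_poly :: "nat \<Rightarrow> complex poly" where
  "cyclotomic_poly n = (\<Prod>\<zeta> | \<zeta> ^ n = 1 \<and> (\<forall>m. 0 < m \<and> m < n \<longrightarrow> \<zeta> ^ m \<noteq> 1). [:-\<zeta>, 1:])"

definition is_cyclotomic :: "int poly \<Rightarrow> bool" where
  "is_cyclotomic f \<longleftrightarrow> (\<exists>n>0. map_poly of_int f = cyclotomic_poly n)"

definition candidates :: "int poly set" where
  "candidates = {f. irreducible f \<and> \<not> is_cyclotomic f \<and> Polynomial.degree f = 3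
                    \<and> mahler_measure f \<le> 8.5}"

text \<open>Polynomials of equal Mahler measure may be listed in any order.\<close>

definition candidate_list :: "int poly list \<Rightarrow> bool" where
  "candidate_list L \<longleftrightarrow> set L = candidates \<and> distinct L
     \<and> sorted_wrt (\<lambda>f g. mahler_measure f \<le> mahler_measure g) L"

definition depressed_A :: "int poly \<Rightarrow> rat" where
  "depressed_A f =
     (let a = of_int (Polynomial.coeff f 3); b = of_int (Polynomial.coeff f 2);
          c = of_int (Polynomial.coeff f 1)
      in (3 * a * c - b ^ 2) / (3 * a ^ 2))"

definition depressed_B :: "int poly \<Rightarrow> rat" where
  "depressed_B f =
     (let a = of_int (Polynomial.coeff f 3); b = of_int (Polynomial.coeff f 2);
          c = of_int (Polynomial.coeff f 1); d = of_int (Polynomial.coeff f 0)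
      in (27 * a ^ 2 * d - 9 * a * b * c + 2 * b ^ 3) / (27 * a ^ 3))"

definition depressed_Delta :: "int poly \<Rightarrow> rat" where
  "depressed_Delta f = depressed_B f ^ 2 + 4 * depressed_A f ^ 3 / 27"

text \<open>The algorithm does not say which square root of \<open>\<Delta>\<close> it takes. A function \<open>s\<close> as below
  records an arbitrary choice, made separately for each polynomial.\<close>

definition sqrt_choice :: "nat \<Rightarrow> (int poly \<Rightarrow> (nat \<Rightarrow> rat) set) \<Rightarrow> bool" where
  "sqrt_choice p s \<longleftrightarrow>
     (\<forall>f. is_power_in (Qp p) 2 (Qp_of_rat p (depressed_Delta f)) \<longrightarrow>
          s f \<in> carrier (Qp p) \<and> s f [^]\<^bsub>Qp p\<^esub> (2::nat) = Qp_of_rat p (depressed_Delta f))"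

definition cardano_C :: "nat \<Rightarrow> (int poly \<Rightarrow> (nat \<Rightarrow> rat) set) \<Rightarrow> int poly \<Rightarrow> (nat \<Rightarrow> rat) set" where
  "cardano_C p s f = (if depressed_A f = 0 then Qp_of_rat p (- depressed_B f) else s f)"

definition cardano_cube :: "nat \<Rightarrow> (int poly \<Rightarrow> (nat \<Rightarrow> rat) set) \<Rightarrow> int poly \<Rightarrow> (nat \<Rightarrow> rat) set" where
  "cardano_cube p s f =
     (Qp_of_rat p (- depressed_B f) \<oplus>\<^bsub>Qp p\<^esub> cardano_C p s f) \<otimes>\<^bsub>Qp p\<^esub> inv\<^bsub>Qp p\<^esub> (Qp_of_rat p 2)"

text \<open>The result \<^const>\<open>None\<close> means that the list is exhausted without any output, that is,
  there is no next polynomial to return to.\<close>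

primrec cubic_search ::
  "nat \<Rightarrow> (int poly \<Rightarrow> (nat \<Rightarrow> rat) set) \<Rightarrow> int poly list \<Rightarrow> real option" where
  "cubic_search p s [] = None"
| "cubic_search p s (f # fs) =
     (if \<not> is_power_in (Qp p) 2 (Qp_of_rat p (depressed_Delta f)) then cubic_search p s fs
      else if \<not> is_power_in (Qp p) 3 (cardano_cube p s f) then cubic_search p s fs
      else Some (1 / 3 * ln (mahler_measure f)))"

end

theory Submission
  imports Defs "HOL-Number_Theory.Residue_Primitive_Roots" "Berlekamp_Zassenhaus.Factor_Bound"
begin

text \<open>
  The field \<open>\<rat>\<^sub>p\<close> contains a primitive cube root of unity \<open>\<omega>\<close>, since \<open>p \<equiv> 1\<close> modulo 3. Over such a field
  the roots of the depressed cubic \<open>x\<^sup>3 + Ax + B\<close> are \<open>u + v\<close>, \<open>\<omega>\<^sup>2u + \<omega>v\<close> and \<open>\<omega>u + \<omega>\<^sup>2v\<close>, where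
  \<open>A = -3uv\<close> and \<open>B = -(u\<^sup>3 + v\<^sup>3)\<close>. Then \<open>\<Delta> = (u\<^sup>3 - v\<^sup>3)\<^sup>2\<close>, so \<open>(-B + C)/2\<close> is \<open>u\<^sup>3\<close> or \<open>v\<^sup>3\<close>; conversely a
  cube root \<open>u\<close> of it gives \<open>v = -A/(3u)\<close>. Hence the test of the algorithm decides whether a cubic splits
  over \<open>\<rat>\<^sub>p\<close>, and the first success on the list has the smallest height among the candidates.

  The list cannot be exhausted: the cubes have index 3 in the cyclic group of units modulo \<open>p\<close>, so one of
  2, 3, 6 and 12 is a cube modulo \<open>p\<close>, hence in \<open>\<rat>\<^sub>p\<close> by Hensel lifting. So one of \<open>x\<^sup>3 - 2\<close>, \<open>x\<^sup>3 - 3\<close>, \<open>x\<^sup>3 - 6\<close>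
  and \<open>2x\<^sup>3 - 3\<close> passes the test, and their Mahler measures are below 8.5. Finally, roots of unity
  of degree 3 do not exist, because a real conjugate of one would be 1 or -1.

  Elements of \<open>\<rat>\<^sub>p\<close> are treated through representing Cauchy sequences; an equation in \<open>\<rat>\<^sub>p\<close> becomes
  membership of a difference in the ideal of null sequences, and is proved by writing that difference
  as an explicit combination of known null sequences.
\<close>

section \<open>The p-adic absolute value\<close>

locale padic =
  fixes p :: nat
  assumes prime: "prime p"
begin

lemma p_gt_1: "real p > 1"
  using prime prime_gt_1_nat by auto

lemma prime_int: "prime (int p)"
  using prime by simp

text \<open>The definition of \<open>padic_abs\<close> reads off the reduced fraction. Comparing
  multiplicities in the cross-multiplied equation extends it to every fraction, so that sums can be
  handled over a common denominator.\<close>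

lemma padic_abs_divide_of_int:
  assumes "a \<noteq> 0" "b \<noteq> 0"
  shows "padic_abs p (of_int a / of_int b) =
           real p powi (int (multiplicity (int p) b) - int (multiplicity (int p) a))"
proof -
  obtain n d where nd: "quotient_of (of_int a / of_int b) = (n, d)"
    by (metis surj_pair)
  have d: "d > 0"
    using nd quotient_of_denom_pos by blast
  have q: "(of_int a / of_int b :: rat) = of_int n / of_int d"
    using nd by (rule quotient_of_div)
  have "(of_int (a * d) :: rat) = of_int (n * b)"
    using q d assms by (simp add: field_simps)
  hence e: "a * d = n * b"
    by (simp only: of_int_eq_iff)
  have n: "n \<noteq> 0"
    using e assms d by auto
  have "multiplicity (int p) a + multiplicity (int p) d = multiplicity (int p) n + multiplicity (int p) b"
    using arg_cong[OF e, of "multiplicity (int p)"] prime_int assms d n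
    by (simp add: prime_elem_multiplicity_mult_distrib)
  hence "int (multiplicity (int p) d) - int (multiplicity (int p) n) =
         int (multiplicity (int p) b) - int (multiplicity (int p) a)"
    by linarith
  thus ?thesis
    using assms by (simp add: padic_abs_def nd)
qed

lemma padic_abs_0 [simp]: "padic_abs p 0 = 0"
  by (simp add: padic_abs_def)

lemma padic_abs_pos: "x \<noteq> 0 \<Longrightarrow> padic_abs p x > 0"
  using p_gt_1 by (simp add: padic_abs_def)

lemma padic_abs_nonneg [simp]: "padic_abs p x \<ge> 0"
  by (cases "x = 0") (auto intro: less_imp_le padic_abs_pos)

lemma padic_abs_eq_0_iff [simp]: "padic_abs p x = 0 \<longleftrightarrow> x = 0"
  using padic_abs_pos[of x] by (cases "x = 0") auto

lemma rat_cases_of_int: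
  fixes x :: rat
  obtains a b where "x = of_int a / of_int b" "b \<noteq> 0"
  by (metis Rat_cases Fract_of_int_quotient less_irrefl)

lemma padic_abs_mult: "padic_abs p (x * y) = padic_abs p x * padic_abs p y"
proof (cases "x = 0 \<or> y = 0")
  case False
  obtain a b where x: "x = of_int a / of_int b" "b \<noteq> 0" by (rule rat_cases_of_int)
  obtain c d where y: "y = of_int c / of_int d" "d \<noteq> 0" by (rule rat_cases_of_int)
  have nz: "a \<noteq> 0" "c \<noteq> 0"
    using False x y by auto
  have xy: "x * y = of_int (a * c) / of_int (b * d)"
    by (simp add: x y)
  have "padic_abs p (x * y) = real p powi (int (multiplicity (int p) (b * d)) - int (multiplicity (int p) (a * c)))"
    unfolding xy by (rule padic_abs_divide_of_int) (use nz x y in auto)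
  also have "\<dots> = real p powi ((int (multiplicity (int p) b) - int (multiplicity (int p) a)) +
      (int (multiplicity (int p) d) - int (multiplicity (int p) c)))"
    using prime_int nz x y by (simp add: prime_elem_multiplicity_mult_distrib algebra_simps)
  also have "\<dots> = padic_abs p x * padic_abs p y"
    using p_gt_1 nz x y by (simp add: padic_abs_divide_of_int power_int_add)
  finally show ?thesis .
qed auto

lemma padic_abs_1 [simp]: "padic_abs p 1 = 1"
  by (simp add: padic_abs_def)

lemma padic_abs_minus [simp]: "padic_abs p (- x) = padic_abs p x"
proof -
  have "padic_abs p (-1) ^ 2 = 1"
    using padic_abs_mult[of "-1" "-1"] by (simp add: power2_eq_square)
  hence "padic_abs p (-1) = 1"
    using padic_abs_nonneg[of "-1"] by (simp add: power2_eq_1_iff)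
  thus ?thesis
    using padic_abs_mult[of "-1" x] by simp
qed

lemma padic_abs_diff_commute: "padic_abs p (x - y) = padic_abs p (y - x)"
  using padic_abs_minus[of "x - y"] by simp

lemma padic_abs_inverse: "padic_abs p (inverse x) = inverse (padic_abs p x)"
proof (cases "x = 0")
  case False
  hence "padic_abs p x * padic_abs p (inverse x) = 1"
    by (simp flip: padic_abs_mult)
  thus ?thesis
    by (metis inverse_unique)
qed auto

text \<open>Over a common denominator, both numerators are divisible by \<open>p\<close> to the
  smaller of their multiplicities, hence so is their sum.\<close>

lemma padic_abs_add_le_max: "padic_abs p (x + y) \<le> max (padic_abs p x) (padic_abs p y)"
proof (cases "x = 0 \<or> y = 0 \<or> x + y = 0")
  case False
  obtain a b where x: "x = of_int a / of_int b" "b \<noteq> 0" by (rule rat_cases_of_int)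
  obtain c d where y: "y = of_int c / of_int d" "d \<noteq> 0" by (rule rat_cases_of_int)
  define m n e where "m = a * d" and "n = c * b" and "e = b * d"
  have e: "e \<noteq> 0" and xe: "x = of_int m / of_int e" and ye: "y = of_int n / of_int e"
    using x y by (auto simp: m_def n_def e_def)
  have xye: "x + y = of_int (m + n) / of_int e"
    by (simp add: xe ye add_divide_distrib)
  have nz: "m \<noteq> 0" "n \<noteq> 0" "m + n \<noteq> 0"
    using False xe ye xye by auto
  have "min (multiplicity (int p) m) (multiplicity (int p) n) \<le> multiplicity (int p) (m + n)"
  proof (rule multiplicity_geI)
    show "int p ^ min (multiplicity (int p) m) (multiplicity (int p) n) dvd m + n"
      by (intro dvd_add multiplicity_dvd') auto
    show "\<not> is_unit (int p)"
      using prime_int not_prime_unit by blast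
  qed (use nz in auto)
  hence "multiplicity (int p) m \<le> multiplicity (int p) (m + n) \<or>
         multiplicity (int p) n \<le> multiplicity (int p) (m + n)"
    by linarith
  moreover have "padic_abs p (x + y) = real p powi (int (multiplicity (int p) e) - int (multiplicity (int p) (m + n)))"
    unfolding xye using nz e by (intro padic_abs_divide_of_int)
  ultimately show ?thesis
    unfolding xe ye using p_gt_1 nz e
    by (auto simp: padic_abs_divide_of_int le_max_iff_disj xe ye intro: power_int_increasing)
qed (auto simp: add_eq_0_iff)

lemma padic_abs_add_le: "padic_abs p (x + y) \<le> padic_abs p x + padic_abs p y"
  using padic_abs_add_le_max[of x y] padic_abs_nonneg[of x] padic_abs_nonneg[of y] by linarith

lemma padic_abs_diff_le: "padic_abs p (x - y) \<le> padic_abs p x + padic_abs p y"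
  using padic_abs_add_le[of x "- y"] by simp

text \<open>Turns divisibility by powers of \<open>p\<close> into p-adic smallness. It is an
  inequality so as to include \<open>m = 0\<close>.\<close>

lemma padic_abs_of_int_le:
  assumes "int p ^ k dvd m"
  shows "padic_abs p (of_int m) \<le> (1 / real p) ^ k"
proof (cases "m = 0")
  case False
  have "k \<le> multiplicity (int p) m"
    by (rule multiplicity_geI) (use assms False prime_int in \<open>auto simp: not_prime_unit\<close>)
  hence "real p powi (- int (multiplicity (int p) m)) \<le> real p powi (- int k)"
    using p_gt_1 by (intro power_int_increasing) auto
  also have "\<dots> = (1 / real p) ^ k"
    by (simp add: power_int_minus power_inverse divide_inverse)
  finally show ?thesis
    using padic_abs_divide_of_int[of m 1] False by simp
qed auto


section \<open>Cauchy sequences and null sequences\<close>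

lemma null_imp_eventually_less:
  assumes "x \<in> padic_null p" "e > 0"
  shows "\<exists>N. \<forall>n\<ge>N. padic_abs p (x n) < e"
  using assms order_tendstoD(2)[of "\<lambda>n. padic_abs p (x n)" 0 sequentially e]
  by (auto simp: padic_null_def eventually_sequentially)

lemma nullI:
  assumes "\<And>e. e > 0 \<Longrightarrow> \<exists>N. \<forall>n\<ge>N. padic_abs p (x n) < e"
  shows "x \<in> padic_null p"
  using assms by (auto simp: padic_null_def LIMSEQ_iff)

lemma null_mono:
  assumes "x \<in> padic_null p" "\<And>n. padic_abs p (y n) \<le> padic_abs p (x n)"
  shows "y \<in> padic_null p"
  using assms by (meson le_less_trans null_imp_eventually_less nullI)

lemma null_add:
  assumes "x \<in> padic_null p" "y \<in> padic_null p"
  shows "(\<lambda>n. x n + y n) \<in> padic_null p"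
proof (rule nullI)
  fix e :: real assume "e > 0"
  then obtain M N where "\<forall>n\<ge>M. padic_abs p (x n) < e" "\<forall>n\<ge>N. padic_abs p (y n) < e"
    using assms null_imp_eventually_less by metis
  hence "\<forall>n\<ge>max M N. padic_abs p (x n + y n) < e"
    using padic_abs_add_le_max le_less_trans by (metis max_less_iff_conj max.bounded_iff)
  thus "\<exists>N. \<forall>n\<ge>N. padic_abs p (x n + y n) < e" by blast
qed

lemma null_uminus: "x \<in> padic_null p \<Longrightarrow> (\<lambda>n. - x n) \<in> padic_null p"
  by (erule null_mono) simp

lemma null_0: "(\<lambda>n. 0) \<in> padic_null p"
  by (simp add: padic_null_def)

lemma null_diff:
  assumes "x \<in> padic_null p" "y \<in> padic_null p"
  shows "(\<lambda>n. x n - y n) \<in> padic_null p"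
  using null_add[OF assms(1) null_uminus[OF assms(2)]] by simp

lemma null_imp_Cauchy:
  assumes "x \<in> padic_null p"
  shows "padic_Cauchy p x"
  unfolding padic_Cauchy_def
proof (intro allI impI)
  fix e :: real assume "e > 0"
  hence "e / 2 > 0" by simp
  then obtain N where "\<forall>n\<ge>N. padic_abs p (x n) < e / 2"
    using null_imp_eventually_less[OF assms] by metis
  hence "\<forall>m\<ge>N. \<forall>n\<ge>N. padic_abs p (x m - x n) < e"
    using padic_abs_diff_le by (smt (verit, best) field_sum_of_halves)
  thus "\<exists>N. \<forall>m\<ge>N. \<forall>n\<ge>N. padic_abs p (x m - x n) < e" by blast
qed

lemma Cauchy_const: "padic_Cauchy p (\<lambda>n. c)"
  by (simp add: padic_Cauchy_def)

lemma Cauchy_bounded: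
  assumes "padic_Cauchy p x"
  obtains K where "K > 0" "\<And>n. padic_abs p (x n) \<le> K"
proof -
  obtain N where N: "\<forall>m\<ge>N. \<forall>n\<ge>N. padic_abs p (x m - x n) < 1"
    using spec[OF assms[unfolded padic_Cauchy_def], of 1] by auto
  \<comment> \<open>The sum dominates each of the finitely many initial values; the extra 1 covers
    the tail, which stays within distance 1 of \<open>x N\<close>.\<close>
  define K where "K = (\<Sum>i\<le>N. padic_abs p (x i)) + 1"
  have le: "padic_abs p (x i) \<le> (\<Sum>i\<le>N. padic_abs p (x i))" if "i \<le> N" for i
    using that by (intro member_le_sum) auto
  have "padic_abs p (x n) \<le> K" for n
  proof (cases "n \<le> N")
    case True
    thus ?thesis using le[of n] by (simp add: K_def)
  next
    case False
    have "padic_abs p (x n) \<le> padic_abs p (x n - x N) + padic_abs p (x N)"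
      using padic_abs_add_le[of "x n - x N" "x N"] by simp
    thus ?thesis using N False le[of N] unfolding K_def
      by (smt (verit, best) nle_le)
  qed
  moreover have "K > 0"
    unfolding K_def by (intro add_nonneg_pos sum_nonneg) auto
  ultimately show ?thesis using that by blast
qed

lemma Cauchy_add:
  assumes "padic_Cauchy p x" "padic_Cauchy p y"
  shows "padic_Cauchy p (\<lambda>n. x n + y n)"
  unfolding padic_Cauchy_def
proof (intro allI impI)
  fix e :: real assume "e > 0"
  then obtain M N where M: "\<forall>m\<ge>M. \<forall>n\<ge>M. padic_abs p (x m - x n) < e"
    and N: "\<forall>m\<ge>N. \<forall>n\<ge>N. padic_abs p (y m - y n) < e"
    using assms unfolding padic_Cauchy_def by metis
  have "padic_abs p (x m + y m - (x n + y n)) < e" if "m \<ge> max M N" "n \<ge> max M N" for m n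
  proof -
    have "padic_abs p ((x m - x n) + (y m - y n)) < e"
      using M N that by (intro le_less_trans[OF padic_abs_add_le_max]) auto
    thus ?thesis by (simp add: algebra_simps)
  qed
  thus "\<exists>N. \<forall>m\<ge>N. \<forall>n\<ge>N. padic_abs p (x m + y m - (x n + y n)) < e" by blast
qed

lemma Cauchy_uminus: "padic_Cauchy p x \<Longrightarrow> padic_Cauchy p (\<lambda>n. - x n)"
proof -
  have "padic_abs p (- a - - b) = padic_abs p (a - b)" for a b
    using padic_abs_diff_commute[of a b] by simp
  thus "padic_Cauchy p x \<Longrightarrow> padic_Cauchy p (\<lambda>n. - x n)"
    unfolding padic_Cauchy_def by presburger
qed

lemma Cauchy_diff:
  assumes "padic_Cauchy p x" "padic_Cauchy p y"
  shows "padic_Cauchy p (\<lambda>n. x n - y n)"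
  using Cauchy_add[OF assms(1) Cauchy_uminus[OF assms(2)]] by simp

lemma Cauchy_mult:
  assumes "padic_Cauchy p x" "padic_Cauchy p y"
  shows "padic_Cauchy p (\<lambda>n. x n * y n)"
  unfolding padic_Cauchy_def
proof (intro allI impI)
  fix e :: real assume e: "e > 0"
  obtain K where K: "K > 0" "\<And>n. padic_abs p (x n) \<le> K" using Cauchy_bounded[OF assms(1)] by metis
  obtain L where L: "L > 0" "\<And>n. padic_abs p (y n) \<le> L" using Cauchy_bounded[OF assms(2)] by metis
  have "e / L > 0" "e / K > 0" using e K L by auto
  then obtain M N where M: "\<forall>m\<ge>M. \<forall>n\<ge>M. padic_abs p (x m - x n) < e / L"
    and N: "\<forall>m\<ge>N. \<forall>n\<ge>N. padic_abs p (y m - y n) < e / K"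
    using assms unfolding padic_Cauchy_def by metis
  have "padic_abs p (x m * y m - x n * y n) < e" if "m \<ge> max M N" "n \<ge> max M N" for m n
  proof -
    have "padic_abs p ((x m - x n) * y m) < e"
    proof -
      have "padic_abs p (x m - x n) * padic_abs p (y m) \<le> padic_abs p (x m - x n) * L"
        using L by (intro mult_left_mono) auto
      also have "\<dots> < e" using M that L by (simp add: pos_less_divide_eq)
      finally show ?thesis by (simp add: padic_abs_mult)
    qed
    moreover have "padic_abs p (x n * (y m - y n)) < e"
    proof -
      have "padic_abs p (x n) * padic_abs p (y m - y n) \<le> K * padic_abs p (y m - y n)"
        using K by (intro mult_right_mono) auto
      also have "\<dots> < e" using N that K by (simp add: pos_less_divide_eq mult.commute)
      finally show ?thesis by (simp add: padic_abs_mult)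
    qed
    ultimately have "padic_abs p ((x m - x n) * y m + x n * (y m - y n)) < e"
      by (intro le_less_trans[OF padic_abs_add_le_max]) auto
    thus ?thesis by (simp add: algebra_simps)
  qed
  thus "\<exists>N. \<forall>m\<ge>N. \<forall>n\<ge>N. padic_abs p (x m * y m - x n * y n) < e" by blast
qed

lemma Cauchy_power: "padic_Cauchy p x \<Longrightarrow> padic_Cauchy p (\<lambda>n. x n ^ k)"
  by (induction k) (auto intro: Cauchy_const Cauchy_mult)

lemma Cauchy_divide_const: "padic_Cauchy p x \<Longrightarrow> padic_Cauchy p (\<lambda>n. x n / c)"
  using Cauchy_mult[OF _ Cauchy_const[of "inverse c"]] by (simp add: divide_inverse)

lemmas Cauchy_intros = Cauchy_const Cauchy_add Cauchy_uminus Cauchy_diff Cauchy_mult Cauchy_power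
  Cauchy_divide_const

lemma null_mult_left:
  assumes "padic_Cauchy p c" "x \<in> padic_null p"
  shows "(\<lambda>n. c n * x n) \<in> padic_null p"
proof (rule nullI)
  fix e :: real assume e: "e > 0"
  obtain K where K: "K > 0" "\<And>n. padic_abs p (c n) \<le> K" using Cauchy_bounded[OF assms(1)] by metis
  have "e / K > 0" using e K by auto
  then obtain N where N: "\<forall>n\<ge>N. padic_abs p (x n) < e / K"
    using null_imp_eventually_less[OF assms(2)] by metis
  have "padic_abs p (c n * x n) < e" if "n \<ge> N" for n
  proof -
    have "padic_abs p (c n) * padic_abs p (x n) \<le> K * padic_abs p (x n)"
      using K by (intro mult_right_mono) auto
    also have "\<dots> < e" using N that K by (simp add: pos_less_divide_eq mult.commute)
    finally show ?thesis by (simp add: padic_abs_mult)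
  qed
  thus "\<exists>N. \<forall>n\<ge>N. padic_abs p (c n * x n) < e" by blast
qed

lemma null_mult_right:
  assumes "x \<in> padic_null p" "padic_Cauchy p c"
  shows "(\<lambda>n. x n * c n) \<in> padic_null p"
  using null_mult_left[OF assms(2,1)] by (simp add: mult.commute)

lemma null_const_iff: "(\<lambda>n. c) \<in> padic_null p \<longleftrightarrow> c = 0"
  by (simp add: padic_null_def LIMSEQ_const_iff)

text \<open>Some \<open>e\<close> is exceeded or attained at arbitrarily late indices; since late
  terms differ by less than \<open>e / 2\<close>, one such index bounds all of them from
  below.\<close>

lemma Cauchy_not_null_bounded_below:
  assumes "padic_Cauchy p x" "x \<notin> padic_null p"
  obtains e N where "e > 0" "\<And>n. n \<ge> N \<Longrightarrow> padic_abs p (x n) \<ge> e"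
proof -
  obtain e where e: "e > 0" "\<And>N. \<exists>n\<ge>N. padic_abs p (x n) \<ge> e"
    using assms(2) nullI by (meson not_le_imp_less)
  have "e / 2 > 0" using e by simp
  then obtain N where N: "\<forall>m\<ge>N. \<forall>n\<ge>N. padic_abs p (x m - x n) < e / 2"
    using assms(1) unfolding padic_Cauchy_def by metis
  obtain M where M: "M \<ge> N" "padic_abs p (x M) \<ge> e" using e(2) by blast
  have "padic_abs p (x n) \<ge> e / 2" if "n \<ge> N" for n
  proof -
    have "padic_abs p (x M - x n) < e / 2" using N M that by blast
    moreover have "padic_abs p (x M) \<le> padic_abs p (x M - x n) + padic_abs p (x n)"
      using padic_abs_add_le[of "x M - x n" "x n"] by simp
    ultimately show ?thesis using M by linarith
  qed
  thus ?thesis using that \<open>e / 2 > 0\<close> by blast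
qed

text \<open>Take termwise reciprocals. Early terms may vanish and then have reciprocal 0, which is
  harmless since only the tail matters modulo null sequences.\<close>

lemma Cauchy_inverse_mod_null:
  assumes "padic_Cauchy p x" "x \<notin> padic_null p"
  obtains y where "padic_Cauchy p y" "(\<lambda>n. x n * y n - 1) \<in> padic_null p"
proof -
  obtain e M where e: "e > 0" and M: "\<And>n. n \<ge> M \<Longrightarrow> padic_abs p (x n) \<ge> e"
    using Cauchy_not_null_bounded_below[OF assms] by metis
  have nz: "x n \<noteq> 0" if "n \<ge> M" for n
    using M[OF that] e by auto
  have "padic_Cauchy p (\<lambda>n. inverse (x n))"
    unfolding padic_Cauchy_def
  proof (intro allI impI)
    fix d :: real assume "d > 0"
    hence "d * (e * e) > 0" using e by simp
    then obtain N where N: "\<forall>m\<ge>N. \<forall>n\<ge>N. padic_abs p (x m - x n) < d * (e * e)"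
      using assms(1) unfolding padic_Cauchy_def by metis
    have "padic_abs p (inverse (x m) - inverse (x n)) < d" if mn: "m \<ge> max M N" "n \<ge> max M N" for m n
    proof -
      have xmn: "x m \<noteq> 0" "x n \<noteq> 0" using nz mn by auto
      have "inverse (x m) - inverse (x n) = (x n - x m) * (inverse (x m) * inverse (x n))"
        using xmn by (simp add: field_simps)
      hence "padic_abs p (inverse (x m) - inverse (x n)) =
          padic_abs p (x n - x m) / (padic_abs p (x m) * padic_abs p (x n))"
        by (simp add: padic_abs_mult padic_abs_inverse divide_inverse)
      also have "\<dots> \<le> padic_abs p (x n - x m) / (e * e)"
        using e M mn xmn by (intro divide_left_mono mult_mono mult_pos_pos padic_abs_pos) auto
      also have "\<dots> < d"
        using N mn e by (simp add: pos_divide_less_eq)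
      finally show ?thesis .
    qed
    thus "\<exists>N. \<forall>m\<ge>N. \<forall>n\<ge>N. padic_abs p (inverse (x m) - inverse (x n)) < d" by blast
  qed
  moreover have "(\<lambda>n. x n * inverse (x n) - 1) \<in> padic_null p"
  proof (rule nullI)
    fix d :: real assume "d > 0"
    hence "\<forall>n\<ge>M. padic_abs p (x n * inverse (x n) - 1) < d"
      using nz by simp
    thus "\<exists>N. \<forall>n\<ge>N. padic_abs p (x n * inverse (x n) - 1) < d" by blast
  qed
  ultimately show ?thesis using that by blast
qed

text \<open>Null sequences form a prime ideal: with \<open>z\<close> inverse to \<open>y\<close>,
  one has x = z(xy) - x(yz - 1). This splits equations such as c^2 = e^2 into c = e or c =
  -e.\<close>

lemma null_mult_imp_null:
  assumes "padic_Cauchy p x" "padic_Cauchy p y" "(\<lambda>n. x n * y n) \<in> padic_null p"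
  shows "x \<in> padic_null p \<or> y \<in> padic_null p"
proof (rule disjCI)
  assume "y \<notin> padic_null p"
  then obtain z where z: "padic_Cauchy p z" "(\<lambda>n. y n * z n - 1) \<in> padic_null p"
    using Cauchy_inverse_mod_null[OF assms(2)] by metis
  have "(\<lambda>n. z n * (x n * y n) - x n * (y n * z n - 1)) \<in> padic_null p"
    by (intro null_diff null_mult_left assms z)
  thus "x \<in> padic_null p" by (simp add: algebra_simps)
qed


section \<open>The quotient field\<close>

lemma padic_Cauchy_ring_cring: "cring (padic_Cauchy_ring p)"
proof (rule cringI)
  show "abelian_group (padic_Cauchy_ring p)"
  proof (rule abelian_groupI)
    fix x assume "x \<in> carrier (padic_Cauchy_ring p)"
    thus "\<exists>y\<in>carrier (padic_Cauchy_ring p). y \<oplus>\<^bsub>padic_Cauchy_ring p\<^esub> x = \<zero>\<^bsub>padic_Cauchy_ring p\<^esub>"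
      by (intro bexI[of _ "\<lambda>n. - x n"]) (auto simp: padic_Cauchy_ring_def intro: Cauchy_intros)
  qed (auto simp: padic_Cauchy_ring_def intro: Cauchy_intros)
  show "Group.comm_monoid (padic_Cauchy_ring p)"
    by (rule comm_monoidI) (auto simp: padic_Cauchy_ring_def intro: Cauchy_intros)
qed (auto simp: padic_Cauchy_ring_def distrib_right)

sublocale CR: cring "padic_Cauchy_ring p"
  by (rule padic_Cauchy_ring_cring)

lemma a_inv_padic_Cauchy_ring:
  assumes "padic_Cauchy p x"
  shows "\<ominus>\<^bsub>padic_Cauchy_ring p\<^esub> x = (\<lambda>n. - x n)"
  by (rule CR.minus_equality) (use assms in \<open>auto simp: padic_Cauchy_ring_def intro: Cauchy_intros\<close>)

lemma padic_null_ideal: "ideal (padic_null p) (padic_Cauchy_ring p)"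
proof (rule idealI[OF CR.ring_axioms])
  show "subgroup (padic_null p) (add_monoid (padic_Cauchy_ring p))"
  proof (rule group.subgroupI)
    show "group (add_monoid (padic_Cauchy_ring p))"
      using CR.a_group .
    show "inv\<^bsub>add_monoid (padic_Cauchy_ring p)\<^esub> x \<in> padic_null p" if "x \<in> padic_null p" for x
      using that null_uminus a_inv_padic_Cauchy_ring[OF null_imp_Cauchy[OF that]]
      by (simp add: a_inv_def)
  qed (use null_0 in \<open>auto simp: padic_Cauchy_ring_def intro: null_add null_imp_Cauchy\<close>)
qed (auto simp: padic_Cauchy_ring_def intro: null_mult_left null_mult_right)

sublocale null: ideal "padic_null p" "padic_Cauchy_ring p"
  by (rule padic_null_ideal)

definition cls :: "(nat \<Rightarrow> rat) \<Rightarrow> (nat \<Rightarrow> rat) set" where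
  "cls x = padic_null p +>\<^bsub>padic_Cauchy_ring p\<^esub> x"

lemma Qp_of_rat_eq_cls: "Qp_of_rat p q = cls (\<lambda>n. q)"
  by (simp add: Qp_of_rat_def cls_def)

lemma carrier_padic_Cauchy_ring: "carrier (padic_Cauchy_ring p) = {x. padic_Cauchy p x}"
  by (simp add: padic_Cauchy_ring_def)

lemma carrier_Qp: "carrier (Qp p) = cls ` {x. padic_Cauchy p x}"
  unfolding Qp_def FactRing_def A_RCOSETS_def' cls_def carrier_padic_Cauchy_ring by auto

lemma cls_in_carrier: "padic_Cauchy p x \<Longrightarrow> cls x \<in> carrier (Qp p)"
  by (simp add: carrier_Qp)

lemma carrier_Qp_imp_cls: "A \<in> carrier (Qp p) \<Longrightarrow> \<exists>x. padic_Cauchy p x \<and> A = cls x"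
  by (auto simp: carrier_Qp)

lemma cls_add: "padic_Cauchy p x \<Longrightarrow> padic_Cauchy p y \<Longrightarrow> cls x \<oplus>\<^bsub>Qp p\<^esub> cls y = cls (\<lambda>n. x n + y n)"
  using null.a_rcos_sum[of x y] by (simp add: cls_def Qp_def FactRing_def padic_Cauchy_ring_def)

lemma cls_mult: "padic_Cauchy p x \<Longrightarrow> padic_Cauchy p y \<Longrightarrow> cls x \<otimes>\<^bsub>Qp p\<^esub> cls y = cls (\<lambda>n. x n * y n)"
  using null.rcoset_mult_add[of x y] by (simp add: cls_def Qp_def FactRing_def padic_Cauchy_ring_def)

lemma cls_1: "\<one>\<^bsub>Qp p\<^esub> = cls (\<lambda>n. 1)"
  by (simp add: cls_def Qp_def FactRing_def padic_Cauchy_ring_def)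

lemma cls_eq_iff:
  assumes "padic_Cauchy p x" "padic_Cauchy p y"
  shows "cls x = cls y \<longleftrightarrow> (\<lambda>n. x n - y n) \<in> padic_null p"
proof -
  have "cls x = cls y \<longleftrightarrow> x \<in> padic_null p +>\<^bsub>padic_Cauchy_ring p\<^esub> y"
    using null.a_repr_independence'[of x y] null.a_repr_independenceD[of x y] assms
    by (auto simp: cls_def padic_Cauchy_ring_def)
  also have "\<dots> \<longleftrightarrow> x \<oplus>\<^bsub>padic_Cauchy_ring p\<^esub> \<ominus>\<^bsub>padic_Cauchy_ring p\<^esub> y \<in> padic_null p"
    using null.a_rcos_module[of y x] assms by (simp add: padic_Cauchy_ring_def)
  also have "\<dots> \<longleftrightarrow> (\<lambda>n. x n - y n) \<in> padic_null p"
    by (simp add: a_inv_padic_Cauchy_ring assms(2)) (simp add: padic_Cauchy_ring_def)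
  finally show ?thesis .
qed

lemma cls_0: "\<zero>\<^bsub>Qp p\<^esub> = cls (\<lambda>n. 0)"
proof -
  have "padic_null p = cls (\<lambda>n. 0)"
    using null.a_rcos_const[OF null_0] by (simp add: cls_def)
  thus ?thesis by (simp add: Qp_def FactRing_def)
qed

lemma Qp_field: "field (Qp p)"
proof -
  interpret Q: cring "Qp p"
    unfolding Qp_def by (rule null.quotient_is_cring[OF padic_Cauchy_ring_cring])
  show ?thesis
  proof (rule Q.cring_fieldI2)
    show "\<zero>\<^bsub>Qp p\<^esub> \<noteq> \<one>\<^bsub>Qp p\<^esub>"
      by (simp add: cls_0 cls_1 cls_eq_iff Cauchy_const null_const_iff)
    fix A assume A: "A \<in> carrier (Qp p)" "A \<noteq> \<zero>\<^bsub>Qp p\<^esub>"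
    then obtain x where x: "padic_Cauchy p x" "A = cls x" using carrier_Qp_imp_cls by blast
    have "x \<notin> padic_null p"
      using A x by (simp add: cls_0 cls_eq_iff Cauchy_const)
    then obtain y where "padic_Cauchy p y" "(\<lambda>n. x n * y n - 1) \<in> padic_null p"
      using Cauchy_inverse_mod_null[OF x(1)] by metis
    thus "\<exists>B\<in>carrier (Qp p). A \<otimes>\<^bsub>Qp p\<^esub> B = \<one>\<^bsub>Qp p\<^esub>"
      using x by (intro bexI[of _ "cls y"])
        (auto simp: cls_mult cls_1 cls_eq_iff Cauchy_intros cls_in_carrier)
  qed
qed

sublocale Q: field "Qp p"
  by (rule Qp_field)

lemma cls_uminus:
  assumes "padic_Cauchy p x"
  shows "\<ominus>\<^bsub>Qp p\<^esub> cls x = cls (\<lambda>n. - x n)"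
  by (rule Q.minus_equality)
    (use assms in \<open>auto simp: cls_add cls_0 Cauchy_intros intro: cls_in_carrier\<close>)

lemma cls_power:
  assumes "padic_Cauchy p x"
  shows "cls x [^]\<^bsub>Qp p\<^esub> (k::nat) = cls (\<lambda>n. x n ^ k)"
  using assms by (induction k) (auto simp: cls_1 cls_mult Cauchy_intros mult.commute)

lemma inv_Qp_of_rat:
  assumes "q \<noteq> 0"
  shows "inv\<^bsub>Qp p\<^esub> (Qp_of_rat p q) = Qp_of_rat p (inverse q)"
  by (rule Q.comm_inv_char)
    (use assms in \<open>auto simp: Qp_of_rat_eq_cls cls_mult cls_1 Cauchy_const intro: cls_in_carrier\<close>)

text \<open>Translates the square and cube tests of the algorithm into statements about Cauchy
  sequences of rationals.\<close>

lemma is_power_in_Qp_cls_iff: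
  assumes "padic_Cauchy p x"
  shows "is_power_in (Qp p) k (cls x) \<longleftrightarrow> (\<exists>y. padic_Cauchy p y \<and> (\<lambda>n. y n ^ k - x n) \<in> padic_null p)"
proof -
  have "is_power_in (Qp p) k (cls x) \<longleftrightarrow> (\<exists>y. padic_Cauchy p y \<and> cls y [^]\<^bsub>Qp p\<^esub> k = cls x)"
    unfolding is_power_in_def by (metis carrier_Qp_imp_cls cls_in_carrier)
  thus ?thesis
    using assms by (auto simp: cls_power cls_eq_iff Cauchy_power)
qed

section \<open>Cardano's formula modulo null sequences\<close>

lemma null_divide_const: "x \<in> padic_null p \<Longrightarrow> (\<lambda>n. x n / c) \<in> padic_null p"
  using null_mult_right[OF _ Cauchy_const[of "inverse c"]] by (simp add: divide_inverse)

lemmas null_intros = null_add null_diff null_uminus null_mult_left null_divide_const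

text \<open>Applied with \<open>e1\<close>, \<open>e2\<close> the elementary symmetric functions of
  the roots, s = uv and h = w^2 + w + 1. Each summand on the left is then a multiple of one of the
  null sequences c - e2, b + e1 and h.\<close>

lemma resolvent_linear_coeff:
  fixes b c e1 e2 h Q s :: rat
  assumes "9 * s = e1 ^ 2 - 3 * e2 + h * Q"
  shows "(c - e2) - (b - e1) / 3 * (b + e1) + Q / 3 * h = (c - b ^ 2 / 3) + 3 * s"
  using assms by (simp add: field_simps power2_eq_square)

text \<open>The analogue for the constant term of the depressed cubic, applied with s = u^3 + v^3
  and e3 = xyz.\<close>

lemma resolvent_constant_coeff:
  fixes b c d e1 e2 e3 h R s :: rat
  assumes "27 * s = 2 * e1 ^ 3 - 9 * e1 * e2 + 27 * e3 + h * R"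
  shows "(d + e3) - c / 3 * (b + e1) + e1 / 3 * (c - e2) + 2 * (b ^ 2 - b * e1 + e1 ^ 2) / 27 * (b + e1)
      + R / 27 * h = (d - b * c / 3 + 2 * b ^ 3 / 27) + s"
  using assms by (simp add: field_simps power2_eq_square power3_eq_cube)

text \<open>\<open>u\<close> and \<open>v\<close> are the Lagrange resolvents divided by 3. Modulo
  w^2 + w + 1, both uv and u^3 + v^3 are symmetric in the roots, hence polynomials in the
  coefficients.\<close>

lemma roots_imp_resolvents:
  fixes b c d :: rat
  assumes W: "padic_Cauchy p w" "(\<lambda>n. w n ^ 2 + w n + 1) \<in> padic_null p"
    and xyz: "padic_Cauchy p x" "padic_Cauchy p y" "padic_Cauchy p z"
    and e1: "(\<lambda>n. b + (x n + y n + z n)) \<in> padic_null p"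
    and e2: "(\<lambda>n. c - (x n * y n + x n * z n + y n * z n)) \<in> padic_null p"
    and e3: "(\<lambda>n. d + x n * y n * z n) \<in> padic_null p"
  obtains u v where "padic_Cauchy p u" "padic_Cauchy p v"
    "(\<lambda>n. (c - b ^ 2 / 3) + 3 * u n * v n) \<in> padic_null p"
    "(\<lambda>n. (d - b * c / 3 + 2 * b ^ 3 / 27) + (u n ^ 3 + v n ^ 3)) \<in> padic_null p"
proof
  define u where "u = (\<lambda>n. (x n + w n * y n + w n ^ 2 * z n) / 3)"
  define v where "v = (\<lambda>n. (x n + w n ^ 2 * y n + w n * z n) / 3)"
  \<comment> \<open>\<open>Q\<close> and \<open>R\<close> are the quotients by \<open>w\<^sup>2 + w + 1\<close> in the facts \<open>uv\<close> and \<open>cubes\<close> below.\<close>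
  define Q where "Q = (\<lambda>n. (w n - 1) * (y n ^ 2 + z n ^ 2) + x n * (y n + z n) + y n * z n * (w n * (w n - 1) + 1))"
  define R where "R = (\<lambda>n. let h = w n ^ 2 + w n + 1; s = 2 * x n - y n - z n; t = y n + z n;
    P = (x n + y n + z n) ^ 2 - 3 * (x n * y n + x n * z n + y n * z n)
    in 3 * s ^ 2 * t + 3 * s * h * t ^ 2 + h ^ 2 * t ^ 3 - 3 * P * t - 3 * Q n * s - 3 * Q n * h * t)"
  show u: "padic_Cauchy p u" and v: "padic_Cauchy p v"
    unfolding u_def v_def by (intro Cauchy_intros W xyz)+
  have Q: "padic_Cauchy p Q"
    unfolding Q_def by (intro Cauchy_intros W xyz)
  have R: "padic_Cauchy p R"
    unfolding R_def Let_def by (intro Cauchy_intros W xyz Q)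
  have u3: "3 * u n = x n + w n * y n + w n ^ 2 * z n" and v3: "3 * v n = x n + w n ^ 2 * y n + w n * z n" for n
    by (simp_all add: u_def v_def)
  have uv: "9 * (u n * v n) = (x n + y n + z n) ^ 2 - 3 * (x n * y n + x n * z n + y n * z n)
      + (w n ^ 2 + w n + 1) * Q n" for n
  proof -
    have "9 * (u n * v n) = (3 * u n) * (3 * v n)"
      by simp
    also have "\<dots> = (x n + y n + z n) ^ 2 - 3 * (x n * y n + x n * z n + y n * z n) + (w n ^ 2 + w n + 1) * Q n"
      unfolding u3 v3 Q_def by (simp add: algebra_simps power2_eq_square)
    finally show ?thesis .
  qed
  have "(\<lambda>n. (c - (x n * y n + x n * z n + y n * z n)) - (b - (x n + y n + z n)) / 3 * (b + (x n + y n + z n))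
      + Q n / 3 * (w n ^ 2 + w n + 1)) \<in> padic_null p"
    by (intro null_intros e1 e2 W Cauchy_intros Q xyz)
  also have "(\<lambda>n. (c - (x n * y n + x n * z n + y n * z n)) - (b - (x n + y n + z n)) / 3 * (b + (x n + y n + z n))
      + Q n / 3 * (w n ^ 2 + w n + 1)) = (\<lambda>n. (c - b ^ 2 / 3) + 3 * u n * v n)"
  proof
    fix n
    show "(c - (x n * y n + x n * z n + y n * z n)) - (b - (x n + y n + z n)) / 3 * (b + (x n + y n + z n))
      + Q n / 3 * (w n ^ 2 + w n + 1) = (c - b ^ 2 / 3) + 3 * u n * v n"
      using resolvent_linear_coeff[OF uv] by (simp add: mult.assoc)
  qed
  finally show "(\<lambda>n. (c - b ^ 2 / 3) + 3 * u n * v n) \<in> padic_null p" .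
  have sum: "3 * (u n + v n) = (2 * x n - y n - z n) + (w n ^ 2 + w n + 1) * (y n + z n)" for n
    using u3[of n] v3[of n] by (simp add: algebra_simps)
  have cubes: "27 * (u n ^ 3 + v n ^ 3) = 2 * (x n + y n + z n) ^ 3
      - 9 * (x n + y n + z n) * (x n * y n + x n * z n + y n * z n) + 27 * (x n * y n * z n)
      + (w n ^ 2 + w n + 1) * R n" for n
  proof -
    \<comment> \<open>Expressing the cubes through u + v and uv lets \<open>sum\<close> and
      \<open>uv\<close> apply, where \<open>w\<close> occurs almost only through w^2 + w +
      1.\<close>
    have "27 * (u n ^ 3 + v n ^ 3) = (3 * (u n + v n)) ^ 3 - 3 * (9 * (u n * v n)) * (3 * (u n + v n))"
      by (simp add: algebra_simps power3_eq_cube)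
    also have "\<dots> = 2 * (x n + y n + z n) ^ 3
      - 9 * (x n + y n + z n) * (x n * y n + x n * z n + y n * z n) + 27 * (x n * y n * z n)
      + (w n ^ 2 + w n + 1) * R n"
      unfolding uv sum R_def Let_def by (simp add: algebra_simps power2_eq_square power3_eq_cube)
    finally show ?thesis .
  qed
  have "(\<lambda>n. (d + x n * y n * z n) - c / 3 * (b + (x n + y n + z n))
      + (x n + y n + z n) / 3 * (c - (x n * y n + x n * z n + y n * z n))
      + 2 * (b ^ 2 - b * (x n + y n + z n) + (x n + y n + z n) ^ 2) / 27 * (b + (x n + y n + z n))
      + R n / 27 * (w n ^ 2 + w n + 1)) \<in> padic_null p"
    by (intro null_intros e1 e2 e3 W Cauchy_intros R xyz)
  also have "(\<lambda>n. (d + x n * y n * z n) - c / 3 * (b + (x n + y n + z n))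
      + (x n + y n + z n) / 3 * (c - (x n * y n + x n * z n + y n * z n))
      + 2 * (b ^ 2 - b * (x n + y n + z n) + (x n + y n + z n) ^ 2) / 27 * (b + (x n + y n + z n))
      + R n / 27 * (w n ^ 2 + w n + 1)) = (\<lambda>n. (d - b * c / 3 + 2 * b ^ 3 / 27) + (u n ^ 3 + v n ^ 3))"
  proof
    fix n
    show "(d + x n * y n * z n) - c / 3 * (b + (x n + y n + z n))
      + (x n + y n + z n) / 3 * (c - (x n * y n + x n * z n + y n * z n))
      + 2 * (b ^ 2 - b * (x n + y n + z n) + (x n + y n + z n) ^ 2) / 27 * (b + (x n + y n + z n))
      + R n / 27 * (w n ^ 2 + w n + 1) = (d - b * c / 3 + 2 * b ^ 3 / 27) + (u n ^ 3 + v n ^ 3)"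
      using resolvent_constant_coeff[OF cubes] by simp
  qed
  finally show "(\<lambda>n. (d - b * c / 3 + 2 * b ^ 3 / 27) + (u n ^ 3 + v n ^ 3)) \<in> padic_null p" .
qed

text \<open>Cardano's three roots of the depressed cubic, shifted back by b/3.\<close>

lemma resolvents_imp_roots:
  fixes b c d :: rat
  assumes W: "padic_Cauchy p w" "(\<lambda>n. w n ^ 2 + w n + 1) \<in> padic_null p"
    and uv: "padic_Cauchy p u" "padic_Cauchy p v"
    and A: "(\<lambda>n. (c - b ^ 2 / 3) + 3 * u n * v n) \<in> padic_null p"
    and B: "(\<lambda>n. (d - b * c / 3 + 2 * b ^ 3 / 27) + (u n ^ 3 + v n ^ 3)) \<in> padic_null p"
  obtains x y z where "padic_Cauchy p x" "padic_Cauchy p y" "padic_Cauchy p z"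
    "(\<lambda>n. b + (x n + y n + z n)) \<in> padic_null p"
    "(\<lambda>n. c - (x n * y n + x n * z n + y n * z n)) \<in> padic_null p"
    "(\<lambda>n. d + x n * y n * z n) \<in> padic_null p"
proof
  \<comment> \<open>The shift that removes the quadratic term; substituting b = 3h keeps the
    identities below free of fractions.\<close>
  define h where "h = b / 3"
  have b: "b = 3 * h"
    by (simp add: h_def)
  define x where "x = (\<lambda>n. u n + v n - h)"
  define y where "y = (\<lambda>n. w n ^ 2 * u n + w n * v n - h)"
  define z where "z = (\<lambda>n. w n * u n + w n ^ 2 * v n - h)"
  \<comment> \<open>With \<open>b = 0\<close>, \<open>y n * z n = u n ^ 2 + v n ^ 2 - u n * v n + (w n ^ 2 + w n + 1) * T n\<close>.\<close>
  define T where "T = (\<lambda>n. (w n - 1) * (u n ^ 2 + v n ^ 2) + u n * v n * (w n * (w n - 1) + 1))"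
  have A': "(\<lambda>n. (c - 3 * h ^ 2) + 3 * u n * v n) \<in> padic_null p"
    using A by (simp add: b power2_eq_square)
  have B': "(\<lambda>n. (d - h * c + 2 * h ^ 3) + (u n ^ 3 + v n ^ 3)) \<in> padic_null p"
    using B by (simp add: b power3_eq_cube mult.assoc)
  show "padic_Cauchy p x" "padic_Cauchy p y" "padic_Cauchy p z"
    unfolding x_def y_def z_def by (intro Cauchy_intros W uv)+
  have T: "padic_Cauchy p T"
    unfolding T_def by (intro Cauchy_intros W uv)
  have "(\<lambda>n. (u n + v n) * (w n ^ 2 + w n + 1)) \<in> padic_null p"
    by (intro null_intros W Cauchy_intros uv)
  also have "(\<lambda>n. (u n + v n) * (w n ^ 2 + w n + 1)) = (\<lambda>n. b + (x n + y n + z n))"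
    unfolding x_def y_def z_def b by (rule ext) (simp add: algebra_simps)
  finally show "(\<lambda>n. b + (x n + y n + z n)) \<in> padic_null p" .
  \<comment> \<open>Let k = w^2 + w + 1. The unshifted roots x + h, y + h, z + h have sum k(u + v),
    second symmetric function k((u + v)^2 + T) - 3uv and product u^3 + v^3 + kT(u + v). Expanding
    the shift by h yields this combination and the one for the constant term.\<close>
  have "(\<lambda>n. ((c - 3 * h ^ 2) + 3 * u n * v n) + (2 * h * (u n + v n) - (u n + v n) ^ 2 - T n) * (w n ^ 2 + w n + 1))
      \<in> padic_null p"
    by (intro null_intros W Cauchy_intros uv T A')
  also have "(\<lambda>n. ((c - 3 * h ^ 2) + 3 * u n * v n) + (2 * h * (u n + v n) - (u n + v n) ^ 2 - T n) * (w n ^ 2 + w n + 1)) =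
      (\<lambda>n. c - (x n * y n + x n * z n + y n * z n))"
    unfolding x_def y_def z_def T_def by (rule ext) (simp add: algebra_simps power2_eq_square power3_eq_cube)
  finally show "(\<lambda>n. c - (x n * y n + x n * z n + y n * z n)) \<in> padic_null p" .
  have "(\<lambda>n. ((d - h * c + 2 * h ^ 3) + (u n ^ 3 + v n ^ 3)) + h * ((c - 3 * h ^ 2) + 3 * u n * v n)
      + (T n * (u n + v n) - h * ((u n + v n) ^ 2 + T n) + h ^ 2 * (u n + v n)) * (w n ^ 2 + w n + 1))
      \<in> padic_null p"
    by (intro null_intros W Cauchy_intros uv T A' B')
  also have "(\<lambda>n. ((d - h * c + 2 * h ^ 3) + (u n ^ 3 + v n ^ 3)) + h * ((c - 3 * h ^ 2) + 3 * u n * v n)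
      + (T n * (u n + v n) - h * ((u n + v n) ^ 2 + T n) + h ^ 2 * (u n + v n)) * (w n ^ 2 + w n + 1)) =
      (\<lambda>n. d + x n * y n * z n)"
    unfolding x_def y_def z_def T_def by (rule ext) (simp add: algebra_simps power2_eq_square power3_eq_cube)
  finally show "(\<lambda>n. d + x n * y n * z n) \<in> padic_null p" .
qed

text \<open>With B = -(u^3 + v^3) and A = -3uv, the discriminant becomes (u^3 + v^3)^2 - 4u^3v^3.
  The explicit combination factors a difference of squares and a sum of cubes.\<close>

lemma resolvents_discriminant:
  fixes A B :: rat
  assumes uv: "padic_Cauchy p u" "padic_Cauchy p v"
    and A: "(\<lambda>n. A + 3 * u n * v n) \<in> padic_null p"
    and B: "(\<lambda>n. B + (u n ^ 3 + v n ^ 3)) \<in> padic_null p"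
  shows "(\<lambda>n. (u n ^ 3 - v n ^ 3) ^ 2 - (B ^ 2 + 4 * A ^ 3 / 27)) \<in> padic_null p"
proof -
  have "(\<lambda>n. - ((B - (u n ^ 3 + v n ^ 3)) * (B + (u n ^ 3 + v n ^ 3)))
      - (4 / 27 * (A ^ 2 - 3 * u n * v n * A + 9 * u n ^ 2 * v n ^ 2)) * (A + 3 * u n * v n)) \<in> padic_null p"
    by (intro null_intros Cauchy_intros uv A B)
  also have "(\<lambda>n. - ((B - (u n ^ 3 + v n ^ 3)) * (B + (u n ^ 3 + v n ^ 3)))
      - (4 / 27 * (A ^ 2 - 3 * u n * v n * A + 9 * u n ^ 2 * v n ^ 2)) * (A + 3 * u n * v n)) =
      (\<lambda>n. (u n ^ 3 - v n ^ 3) ^ 2 - (B ^ 2 + 4 * A ^ 3 / 27))"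
    by (rule ext) (simp add: field_simps power2_eq_square power3_eq_cube)
  finally show ?thesis .
qed

text \<open>Any square root \<open>c\<close> of the discriminant is u^3 - v^3 or its negative,
  because the null ideal is prime. Thus the outcome is a cube whichever root was chosen.\<close>

lemma resolvents_imp_cube:
  fixes A B :: rat
  assumes uv: "padic_Cauchy p u" "padic_Cauchy p v"
    and A: "(\<lambda>n. A + 3 * u n * v n) \<in> padic_null p"
    and B: "(\<lambda>n. B + (u n ^ 3 + v n ^ 3)) \<in> padic_null p"
    and c: "padic_Cauchy p c" "(\<lambda>n. c n ^ 2 - (B ^ 2 + 4 * A ^ 3 / 27)) \<in> padic_null p"
  shows "\<exists>t. padic_Cauchy p t \<and> (\<lambda>n. t n ^ 3 - (- B + c n) / 2) \<in> padic_null p"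
proof -
  have "(\<lambda>n. (c n ^ 2 - (B ^ 2 + 4 * A ^ 3 / 27)) - ((u n ^ 3 - v n ^ 3) ^ 2 - (B ^ 2 + 4 * A ^ 3 / 27))) \<in> padic_null p"
    by (intro null_intros c resolvents_discriminant uv A B)
  hence "(\<lambda>n. (c n - (u n ^ 3 - v n ^ 3)) * (c n + (u n ^ 3 - v n ^ 3))) \<in> padic_null p"
    by (simp add: algebra_simps power2_eq_square)
  hence "(\<lambda>n. c n - (u n ^ 3 - v n ^ 3)) \<in> padic_null p \<or> (\<lambda>n. c n + (u n ^ 3 - v n ^ 3)) \<in> padic_null p"
    by (intro null_mult_imp_null Cauchy_intros uv c)
  thus ?thesis
  proof
    assume *: "(\<lambda>n. c n - (u n ^ 3 - v n ^ 3)) \<in> padic_null p"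
    have "(\<lambda>n. ((B + (u n ^ 3 + v n ^ 3)) - (c n - (u n ^ 3 - v n ^ 3))) / 2) \<in> padic_null p"
      by (intro null_intros * B)
    also have "(\<lambda>n. ((B + (u n ^ 3 + v n ^ 3)) - (c n - (u n ^ 3 - v n ^ 3))) / 2) = (\<lambda>n. u n ^ 3 - (- B + c n) / 2)"
      by (rule ext) (simp add: field_simps)
    finally show ?thesis using uv by blast
  next
    assume *: "(\<lambda>n. c n + (u n ^ 3 - v n ^ 3)) \<in> padic_null p"
    have "(\<lambda>n. ((B + (u n ^ 3 + v n ^ 3)) - (c n + (u n ^ 3 - v n ^ 3))) / 2) \<in> padic_null p"
      by (intro null_intros * B)
    also have "(\<lambda>n. ((B + (u n ^ 3 + v n ^ 3)) - (c n + (u n ^ 3 - v n ^ 3))) / 2) = (\<lambda>n. v n ^ 3 - (- B + c n) / 2)"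
      by (rule ext) (simp add: field_simps)
    finally show ?thesis using uv by blast
  qed
qed

text \<open>For A = 0 the discriminant is B^2, and the choice c = B would make the tested element 0,
  a cube regardless of B. The premise \<open>A0\<close> excludes this, which is why the algorithm
  prescribes C = -B there.\<close>

lemma cube_imp_resolvents:
  fixes A B :: rat
  assumes c: "padic_Cauchy p c" "(\<lambda>n. c n ^ 2 - (B ^ 2 + 4 * A ^ 3 / 27)) \<in> padic_null p"
    and A0: "A = 0 \<Longrightarrow> (\<lambda>n. c n + B) \<in> padic_null p"
    and t: "padic_Cauchy p t" "(\<lambda>n. t n ^ 3 - (- B + c n) / 2) \<in> padic_null p"
  obtains u v where "padic_Cauchy p u" "padic_Cauchy p v"
    "(\<lambda>n. A + 3 * u n * v n) \<in> padic_null p" "(\<lambda>n. B + (u n ^ 3 + v n ^ 3)) \<in> padic_null p"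
proof (cases "t \<in> padic_null p")
  case True
  \<comment> \<open>A vanishing cube root forces c = B, so A^3 = 0; then c = -B as well, so B = 0
    and both resolvents can be taken to be 0.\<close>
  have "(\<lambda>n. 2 * (t n ^ 2 * t n - (t n ^ 3 - (- B + c n) / 2))) \<in> padic_null p"
    by (intro null_intros t True Cauchy_intros)
  hence cB: "(\<lambda>n. c n - B) \<in> padic_null p"
    by (simp add: field_simps power2_eq_square power3_eq_cube)
  have "(\<lambda>n. (c n + B) * (c n - B) - (c n ^ 2 - (B ^ 2 + 4 * A ^ 3 / 27))) \<in> padic_null p"
    by (intro null_intros cB c Cauchy_intros)
  also have "(\<lambda>n. (c n + B) * (c n - B) - (c n ^ 2 - (B ^ 2 + 4 * A ^ 3 / 27))) = (\<lambda>n. 4 * A ^ 3 / 27)"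
    by (rule ext) (simp add: field_simps power2_eq_square)
  finally have A: "A = 0"
    by (simp add: null_const_iff)
  have "(\<lambda>n. (c n + B) - (c n - B)) \<in> padic_null p"
    by (intro null_intros cB A0 A)
  hence "B = 0"
    by (simp add: null_const_iff)
  thus ?thesis
    using that[of "\<lambda>n. 0" "\<lambda>n. 0"] A by (simp add: Cauchy_const null_0)
next
  case False
  then obtain z where z: "padic_Cauchy p z" "(\<lambda>n. t n * z n - 1) \<in> padic_null p"
    using Cauchy_inverse_mod_null[OF t(1)] by metis
  \<comment> \<open>Since \<open>z\<close> represents 1/t, this is v = -A/(3t).\<close>
  define v where "v = (\<lambda>n. - (A * z n / 3))"
  have v: "padic_Cauchy p v"
    unfolding v_def by (intro Cauchy_intros z)
  have "(\<lambda>n. - A * (t n * z n - 1)) \<in> padic_null p"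
    by (intro null_intros z Cauchy_intros)
  hence 1: "(\<lambda>n. A + 3 * t n * v n) \<in> padic_null p"
    by (simp add: v_def algebra_simps)
  have v3: "v n ^ 3 = - (A ^ 3 * z n ^ 3 / 27)" for n
    by (simp add: v_def power_mult_distrib power_divide)
  \<comment> \<open>With e = tz - 1, (tz)^3 - 1 = e(3 + 3e + e^2); \<open>k\<close> is the cofactor
    of e after multiplication by (c + B)/2.\<close>
  define k where "k = (\<lambda>n. (c n + B) / 2 * (3 + 3 * (t n * z n - 1) + (t n * z n - 1) ^ 2))"
  have k: "padic_Cauchy p k"
    unfolding k_def by (intro Cauchy_intros c t z)
  have k': "k n * (t n * z n - 1) = (c n + B) / 2 * (t n ^ 3 * z n ^ 3 - 1)" for n
    unfolding k_def by (simp add: algebra_simps power2_eq_square power3_eq_cube)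
  \<comment> \<open>In the quotient field, v^3 = -A^3 z^3/27 = -(c^2 - B^2)z^3/4 = -(c + B)/2
    because t^3 = (c - B)/2 and tz = 1; adding t^3 gives -B. The combination records the null errors
    of these replacements.\<close>
  have "(\<lambda>n. (t n ^ 3 - (- B + c n) / 2) - k n * (t n * z n - 1) + (c n + B) * z n ^ 3 / 2 * (t n ^ 3 - (- B + c n) / 2)
      + z n ^ 3 / 4 * (c n ^ 2 - (B ^ 2 + 4 * A ^ 3 / 27))) \<in> padic_null p"
    by (intro null_intros z t c Cauchy_intros k)
  also have "(\<lambda>n. (t n ^ 3 - (- B + c n) / 2) - k n * (t n * z n - 1) + (c n + B) * z n ^ 3 / 2 * (t n ^ 3 - (- B + c n) / 2)
      + z n ^ 3 / 4 * (c n ^ 2 - (B ^ 2 + 4 * A ^ 3 / 27))) = (\<lambda>n. B + (t n ^ 3 + v n ^ 3))"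
    unfolding k' v3 by (rule ext) (simp add: field_simps power2_eq_square)
  finally have 2: "(\<lambda>n. B + (t n ^ 3 + v n ^ 3)) \<in> padic_null p" .
  show ?thesis
    using that[OF t(1) v 1 2] .
qed

section \<open>Cube roots by Hensel lifting\<close>

text \<open>Newton's step y = x + p^k t: modulo p^(k+1) only the linear term 3x^2 t matters, as 2k
  >= k + 1, and 3x^2 is invertible modulo \<open>p\<close>.\<close>

lemma cube_root_lift:
  assumes dvd: "int p ^ k dvd x ^ 3 - a" and k: "k > 0" and nd: "\<not> int p dvd 3 * x"
  obtains y where "int p ^ Suc k dvd y ^ 3 - a" "int p ^ k dvd y - x"
proof -
  obtain m where m: "x ^ 3 - a = int p ^ k * m"
    using dvd by blast
  have "\<not> int p dvd 3 * x ^ 2"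
    using nd prime_dvd_power[OF prime_int] by (auto simp: prime_dvd_mult_iff[OF prime_int])
  hence "algebraic_semidom_class.coprime (3 * x ^ 2) (int p)"
    by (subst algebraic_semidom_class.coprime_commute) (rule prime_imp_coprime[OF prime_int])
  then obtain r where "[3 * x ^ 2 * r = 1] (mod int p)"
    using cong_solve_coprime_int by blast
  from cong_scalar_right[OF this, of "- m"] obtain t where "[3 * x ^ 2 * t = - m] (mod int p)"
    by (auto simp: mult.assoc simp del: mult_minus_right)
  then obtain s where s: "3 * x ^ 2 * t + m = int p * s"
    by (auto simp: cong_iff_dvd_diff elim: dvdE)
  obtain j where j: "k = Suc j"
    using k by (cases k) auto
  define y where "y = x + int p ^ k * t"
  have "y ^ 3 - a = (x ^ 3 - a) + int p ^ k * (3 * x ^ 2 * t) + int p ^ (k + k) * (3 * x * t ^ 2 + int p ^ k * t ^ 3)"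
    by (simp add: y_def algebra_simps power2_eq_square power3_eq_cube power_add)
  also have "\<dots> = int p ^ k * (3 * x ^ 2 * t + m) + int p ^ (k + k) * (3 * x * t ^ 2 + int p ^ k * t ^ 3)"
    by (simp add: m algebra_simps)
  also have "\<dots> = int p ^ Suc k * (s + int p ^ j * (3 * x * t ^ 2 + int p ^ k * t ^ 3))"
    unfolding s by (simp add: j algebra_simps power_add)
  finally have "int p ^ Suc k dvd y ^ 3 - a"
    by simp
  moreover have "int p ^ k dvd y - x"
    by (simp add: y_def)
  ultimately show ?thesis using that by blast
qed

text \<open>Iterated lifting. The last conclusion keeps the root in the residue class of
  \<open>x0\<close>, which later separates a primitive cube root of unity from 1.\<close>

lemma Cauchy_cube_root:
  assumes dvd: "int p dvd x0 ^ 3 - a" and nd: "\<not> int p dvd 3 * x0"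
  obtains x where "padic_Cauchy p x" "(\<lambda>n. x n ^ 3 - of_int a) \<in> padic_null p"
    "\<And>n. padic_abs p (x n - of_int x0) < 1"
proof -
  \<comment> \<open>Stage n works modulo p^(n+1), so the exponent is positive from the start, as the
    lifting step requires.\<close>
  define P where "P = (\<lambda>n x. int p ^ Suc n dvd x ^ 3 - a \<and> int p dvd x - x0)"
  have "\<exists>x. \<forall>n. P n (x n) \<and> int p ^ Suc n dvd x (Suc n) - x n"
  proof (rule dependent_nat_choice)
    show "\<exists>x. P 0 x"
      using dvd by (auto simp: P_def intro: exI[of _ x0])
    fix x n assume x: "P n x"
    have "\<not> int p dvd 3 * x"
    proof
      assume "int p dvd 3 * x"
      hence "int p dvd 3 * x - 3 * (x - x0)"
        by (rule dvd_diff) (use x in \<open>auto simp: P_def simp del: right_diff_distrib_numeral\<close>)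
      thus False using nd by simp
    qed
    then obtain y where y: "int p ^ Suc (Suc n) dvd y ^ 3 - a" "int p ^ Suc n dvd y - x"
      using cube_root_lift[of "Suc n" x a] x unfolding P_def by blast
    have "int p dvd (y - x) + (x - x0)"
      using x y(2) unfolding P_def by (intro dvd_add) (auto intro: dvd_mult_left)
    thus "\<exists>y. P (Suc n) y \<and> int p ^ Suc n dvd y - x"
      using y by (auto simp: P_def)
  qed
  then obtain x where x: "\<And>n. P n (x n)" "\<And>n. int p ^ Suc n dvd x (Suc n) - x n"
    by blast
  have step: "int p ^ Suc n dvd x m - x n" if "n \<le> m" for m n
    using that
  proof (induction m rule: dec_induct)
    case (step m)
    have "int p ^ Suc n dvd x (Suc m) - x m"
      using x(2)[of m] step by (meson Suc_le_mono dvd_trans le_imp_power_dvd)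
    from dvd_add[OF this step.IH] show ?case by simp
  qed simp
  have small: "\<exists>N. (1 / real p) ^ N < e" if "e > 0" for e :: real
    using real_arch_pow_inv[of e "1 / real p"] p_gt_1 that by auto
  have dec: "(1 / real p) ^ Suc n \<le> (1 / real p) ^ N" if "n \<ge> N" for n N
    using p_gt_1 that by (intro power_decreasing) auto
  show ?thesis
  proof (rule that[of "\<lambda>n. of_int (x n)"])
    show "padic_Cauchy p (\<lambda>n. of_int (x n))"
      unfolding padic_Cauchy_def
    proof (intro allI impI)
      fix e :: real assume "e > 0"
      then obtain N where N: "(1 / real p) ^ N < e" using small by blast
      have "padic_abs p (of_int (x m) - of_int (x n)) < e" if "m \<ge> N" "n \<ge> N" "n \<le> m" for m n
        using padic_abs_of_int_le[OF step[OF that(3)]] dec[OF that(2)] N by simp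
      hence "\<forall>m\<ge>N. \<forall>n\<ge>N. padic_abs p (of_int (x m) - of_int (x n)) < e"
        by (metis nle_le padic_abs_diff_commute)
      thus "\<exists>N. \<forall>m\<ge>N. \<forall>n\<ge>N. padic_abs p (of_int (x m) - of_int (x n)) < e" by blast
    qed
    show "(\<lambda>n. of_int (x n) ^ 3 - of_int a) \<in> padic_null p"
    proof (rule nullI)
      fix e :: real assume "e > 0"
      then obtain N where N: "(1 / real p) ^ N < e" using small by blast
      have "padic_abs p (of_int (x n) ^ 3 - of_int a) < e" if "n \<ge> N" for n
        using padic_abs_of_int_le[of "Suc n" "x n ^ 3 - a"] x(1)[of n] dec[OF that] N
        by (simp add: P_def)
      thus "\<exists>N. \<forall>n\<ge>N. padic_abs p (of_int (x n) ^ 3 - of_int a) < e" by blast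
    qed
    fix n
    have "padic_abs p (of_int (x n - x0)) \<le> (1 / real p) ^ 1"
      by (rule padic_abs_of_int_le) (use x(1)[of n] in \<open>simp add: P_def\<close>)
    also have "\<dots> < 1"
      using p_gt_1 by simp
    finally show "padic_abs p (of_int (x n) - of_int x0) < 1" by simp
  qed
qed

lemma padic_abs_of_int_eq_1:
  assumes "\<not> int p dvd m"
  shows "padic_abs p (of_int m) = 1"
  using padic_abs_divide_of_int[of m 1] assms by (auto simp: not_dvd_imp_multiplicity_0)

end

section \<open>Cube roots of unity and of small integers for p congruent to 1 modulo 3\<close>

locale padic_1_mod_3 = padic +
  assumes cong: "[p = 1] (mod 3)"
begin

lemma p_mod_3: "p mod 3 = 1"
  using cong by (simp add: cong_def)

text \<open>12 is a common multiple of 2, 3, 6 and 12, the integers tested for being cubes below,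
  and of the factor 3 in the derivative 3x^2.\<close>

lemma not_p_dvd_12: "\<not> int p dvd 12"
proof
  assume "int p dvd 12"
  hence "p dvd 2 * 2 * 3"
    using int_dvd_int_iff[of p 12] by simp
  hence "p dvd 2 \<or> p dvd 3"
    using prime prime_dvd_mult_nat by blast
  hence "p = 2 \<or> p = 3"
    using primes_dvd_imp_eq[OF prime, of 2] primes_dvd_imp_eq[OF prime, of 3] by auto
  thus False using p_mod_3 by auto
qed

text \<open>A generator of the units modulo \<open>p\<close>: surjectivity of its powers provides
  discrete logarithms, its exact order a primitive cube root of unity.\<close>

lemma primitive_root_power:
  "\<exists>g. (\<forall>m. \<not> p dvd m \<longrightarrow> (\<exists>i. [g ^ i = m] (mod p))) \<and> [g ^ (p - 1) = 1] (mod p) \<and>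
     (\<forall>i. 0 < i \<and> i < p - 1 \<longrightarrow> \<not> [g ^ i = 1] (mod p))"
proof -
  obtain g where g: "residue_primroot p g"
    using prime_primitive_root_exists[of p] prime_gt_1_nat[OF prime] prime by blast
  have bij: "bij_betw (\<lambda>i. g ^ i mod p) {..<totient p} (totatives p)"
    using residue_primroot_is_generator[OF _ g] prime_gt_1_nat[OF prime] by simp
  have 1: "\<exists>i. [g ^ i = m] (mod p)" if "\<not> p dvd m" for m
  proof -
    have "m mod p \<in> totatives p"
      using that prime prime_gt_0_nat[OF prime]
      by (auto simp: totatives_prime mod_greater_zero_iff_not_dvd)
    hence "m mod p \<in> (\<lambda>i. g ^ i mod p) ` {..<totient p}"
      using bij_betw_imp_surj_on[OF bij] by simp
    then obtain i where "g ^ i mod p = m mod p"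
      by auto
    thus ?thesis by (auto simp: cong_def)
  qed
  have ord: "ord p g = p - 1"
    using g prime by (simp add: residue_primroot_def totient_prime)
  show ?thesis
  proof (rule exI[of _ g], intro conjI allI impI)
    show "[g ^ (p - 1) = 1] (mod p)"
      using ord_divides[of g "p - 1" p] ord by simp
    fix i assume "0 < i \<and> i < p - 1"
    thus "\<not> [g ^ i = 1] (mod p)"
      using ord_divides[of g i p] ord by (auto dest: dvd_imp_le)
  qed (rule 1)
qed

text \<open>The residue g^((p-1)/3) is a cube root of 1 other than 1. Its lift satisfies (w - 1)(w^2
  + w + 1) = 0, and the first factor does not vanish.\<close>

lemma Cauchy_cube_root_of_unity:
  obtains w where "padic_Cauchy p w" "(\<lambda>n. w n ^ 2 + w n + 1) \<in> padic_null p"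
proof -
  obtain g where g: "[g ^ (p - 1) = 1] (mod p)" "\<And>i. 0 < i \<Longrightarrow> i < p - 1 \<Longrightarrow> \<not> [g ^ i = 1] (mod p)"
    using primitive_root_power by blast
  \<comment> \<open>As p is 1 modulo 3, this is (p - 1)/3.\<close>
  define k where "k = p div 3"
  have k: "p - 1 = 3 * k" "k > 0"
    using p_mod_3 prime_gt_1_nat[OF prime] mult_div_mod_eq[of 3 p] unfolding k_def by linarith+
  define x0 where "x0 = int (g ^ k)"
  have "[(g ^ k) ^ 3 = 1] (mod p)"
    using g(1) k by (simp add: mult.commute flip: power_mult)
  hence "[x0 ^ 3 = 1] (mod int p)"
    using cong_int_iff[of "(g ^ k) ^ 3" 1 p] by (simp add: x0_def)
  hence x0: "int p dvd x0 ^ 3 - 1"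
    by (simp add: cong_iff_dvd_diff)
  have "\<not> [x0 = 1] (mod int p)"
    using g(2)[of k] k cong_int_iff[of "g ^ k" 1 p] by (simp add: x0_def)
  hence x0': "\<not> int p dvd x0 - 1"
    by (simp add: cong_iff_dvd_diff)
  have nd: "\<not> int p dvd 3 * x0"
  proof
    assume "int p dvd 3 * x0"
    hence "int p dvd 3 \<or> int p dvd x0"
      using prime_int prime_dvd_mult_iff by blast
    moreover have "\<not> int p dvd 3"
      using not_p_dvd_12 dvd_trans[of "int p" 3 12] by auto
    moreover have "\<not> int p dvd x0"
    proof
      assume "int p dvd x0"
      hence "int p dvd x0 ^ 3"
        by (simp add: dvd_power dvd_trans)
      from dvd_diff[OF this x0] show False
        using prime_int not_prime_unit by auto
    qed
    ultimately show False by blast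
  qed
  obtain w where w: "padic_Cauchy p w" "(\<lambda>n. w n ^ 3 - of_int 1) \<in> padic_null p"
    "\<And>n. padic_abs p (w n - of_int x0) < 1"
    using Cauchy_cube_root[OF x0 nd] by metis
  have "(\<lambda>n. (w n - 1) * (w n ^ 2 + w n + 1)) \<in> padic_null p"
    using w(2) by (simp add: algebra_simps power2_eq_square power3_eq_cube)
  hence "(\<lambda>n. w n - 1) \<in> padic_null p \<or> (\<lambda>n. w n ^ 2 + w n + 1) \<in> padic_null p"
    by (intro null_mult_imp_null Cauchy_intros w)
  \<comment> \<open>Otherwise w n would be close both to 1 and to \<open>x0\<close>, and the
    ultrametric inequality would make x0 - 1 divisible by \<open>p\<close>.\<close>
  moreover have "(\<lambda>n. w n - 1) \<notin> padic_null p"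
  proof
    assume "(\<lambda>n. w n - 1) \<in> padic_null p"
    then obtain n where n: "padic_abs p (w n - 1) < 1"
      using null_imp_eventually_less[of "\<lambda>n. w n - 1" 1] by auto
    have "padic_abs p (of_int (x0 - 1)) = padic_abs p ((w n - 1) - (w n - of_int x0))"
      by simp
    also have "\<dots> < 1"
      using padic_abs_add_le_max[of "w n - 1" "- (w n - of_int x0)"] n w(3)[of n]
        padic_abs_minus[of "w n - of_int x0"] by simp
    finally show False
      using padic_abs_of_int_eq_1[OF x0'] by simp
  qed
  ultimately show ?thesis using that w by blast
qed

text \<open>A divisor of 12 is prime to \<open>p\<close>, so its cube root modulo \<open>p\<close>
  is a unit and lifts.\<close>

lemma is_cube_of_int:
  assumes "int p dvd x0 ^ 3 - a" "a dvd 12"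
  shows "is_power_in (Qp p) 3 (Qp_of_rat p (of_int a))"
proof -
  have "\<not> int p dvd 3 * x0"
  proof
    assume "int p dvd 3 * x0"
    hence "int p dvd 3 \<or> int p dvd x0"
      using prime_int prime_dvd_mult_iff by blast
    moreover have "\<not> int p dvd 3"
      using not_p_dvd_12 dvd_trans[of "int p" 3 12] by auto
    moreover have "\<not> int p dvd x0"
    proof
      assume "int p dvd x0"
      hence "int p dvd x0 ^ 3"
        by (simp add: dvd_power dvd_trans)
      from dvd_diff[OF this assms(1)] have "int p dvd a"
        by simp
      thus False using not_p_dvd_12 assms(2) dvd_trans by auto
    qed
    ultimately show False by blast
  qed
  then obtain x where "padic_Cauchy p x" "(\<lambda>n. x n ^ 3 - of_int a) \<in> padic_null p"
    using Cauchy_cube_root[OF assms(1)] by metis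
  thus ?thesis
    by (auto simp: Qp_of_rat_eq_cls is_power_in_Qp_cls_iff Cauchy_const)
qed

text \<open>If 2 and 3 have discrete logarithms i and j, then 6 and 12 have i + j and 2i + j. When 3
  divides neither i nor j, these are opposite or equal modulo 3, so 3 divides i + j or 2i +
  j.\<close>

lemma some_cube_mod_p:
  obtains x :: int and a where "int p dvd x ^ 3 - a" "a \<in> {2, 3, 6, 12}"
proof -
  obtain g where g: "\<And>m. \<not> p dvd m \<Longrightarrow> \<exists>i. [g ^ i = m] (mod p)"
    using primitive_root_power by blast
  have "\<not> p dvd 2" "\<not> p dvd 3"
    using not_p_dvd_12 int_dvd_int_iff[of p 2] int_dvd_int_iff[of p 3]
      dvd_trans[of "int p" 2 12] dvd_trans[of "int p" 3 12] by auto
  then obtain i j where ij: "[g ^ i = 2] (mod p)" "[g ^ j = 3] (mod p)"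
    using g by blast
  note * = that
  have main: thesis if e: "[g ^ (3 * k) = m] (mod p)" and m: "int m \<in> {2, 3, 6, 12}" for k m
  proof (rule *[of "int (g ^ k)" "int m"])
    have "[(g ^ k) ^ 3 = m] (mod p)"
      using e by (simp add: mult.commute flip: power_mult)
    hence "[int (g ^ k) ^ 3 = int m] (mod int p)"
      using cong_int_iff[of "(g ^ k) ^ 3" m p] by simp
    thus "int p dvd int (g ^ k) ^ 3 - int m"
      by (simp add: cong_iff_dvd_diff)
  qed (use m in auto)
  have 6: "[g ^ (i + j) = 6] (mod p)"
    using cong_mult[OF ij] by (simp add: power_add)
  have 12: "[g ^ (i + i + j) = 12] (mod p)"
    using cong_mult[OF cong_mult[OF ij(1) ij(1)] ij(2)] by (simp add: power_add)
  have "3 dvd i \<or> 3 dvd j \<or> 3 dvd i + j \<or> 3 dvd i + i + j"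
    by presburger
  thus thesis
    using main[where m = 2] main[where m = 3] main[where m = 6] main[where m = 12] ij 6 12 by (elim disjE dvdE) auto
qed

end

section \<open>Split cubics over a field\<close>

context field
begin

text \<open>\<open>splitted\<close> compares the number of roots, with multiplicity, to the degree;
  removing a linear factor lowers both by one.\<close>

lemma linear_factor_of_splitted:
  assumes q: "q \<in> carrier (poly_ring R)" "q \<noteq> []" "splitted q" "length q - 1 = Suc n"
  obtains x r where "x \<in> carrier R" "r \<in> carrier (poly_ring R)" "r \<noteq> []" "splitted r" "length r - 1 = n"
    "q = [ \<one>, \<ominus> x ] \<otimes>\<^bsub>poly_ring R\<^esub> r"
proof -
  interpret UP: domain "poly_ring R"
    using univ_poly_is_domain[OF carrier_is_subring] .
  have "roots q \<noteq> {#}"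
    using q by (auto simp: splitted_def)
  then obtain x where x: "x \<in> carrier R" "[ \<one>, \<ominus> x ] \<in> carrier (poly_ring R)" "[ \<one>, \<ominus> x ] pdivides q"
    using not_empty_rootsE[OF q(1)] by metis
  then obtain r where r: "r \<in> carrier (poly_ring R)" "q = [ \<one>, \<ominus> x ] \<otimes>\<^bsub>poly_ring R\<^esub> r"
    unfolding pdivides_def by (auto elim: dividesE)
  have r0: "r \<noteq> []"
    using q(2) r x UP.r_null[OF x(2)] by (auto simp: univ_poly_zero)
  have "roots q = add_mset x (roots r)"
    unfolding r(2) by (rule poly_mult_degree_one_monic_imp_same_roots[OF x(1) r(1) r0])
  moreover have deg: "length q - 1 = Suc (length r - 1)"
    unfolding r(2) using poly_mult_degree_eq[OF carrier_is_subring, of "[ \<one>, \<ominus> x ]" r] x r r0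
    by (simp add: univ_poly_carrier univ_poly_mult)
  ultimately have "splitted r"
    using q(3) by (simp add: splitted_def)
  thus ?thesis
    using that x r r0 deg q(4) by auto
qed

lemma splitted_linear_mult:
  assumes "x \<in> carrier R" "r \<in> carrier (poly_ring R)" "r \<noteq> []" "splitted r"
  shows "splitted ([ \<one>, \<ominus> x ] \<otimes>\<^bsub>poly_ring R\<^esub> r)"
proof -
  have "[ \<one>, \<ominus> x ] \<in> carrier (poly_ring R)"
    using assms(1) by (simp add: univ_poly_carrier[symmetric] polynomial_def)
  hence "length ([ \<one>, \<ominus> x ] \<otimes>\<^bsub>poly_ring R\<^esub> r) - 1 = Suc (length r - 1)"
    using poly_mult_degree_eq[OF carrier_is_subring, of "[ \<one>, \<ominus> x ]" r] assms
    by (simp add: univ_poly_carrier univ_poly_mult)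
  thus ?thesis
    using poly_mult_degree_one_monic_imp_same_roots[OF assms(1-3)] assms(4) by (simp add: splitted_def)
qed

lemma linear_mult_const:
  assumes "x \<in> carrier R" "a \<in> carrier R" "a \<noteq> \<zero>"
  shows "[ \<one>, \<ominus> x ] \<otimes>\<^bsub>poly_ring R\<^esub> [ a ] = [ a, \<ominus> (x \<otimes> a) ]"
  using assms by (simp add: univ_poly_mult l_minus)

lemma linear_mult_linear:
  assumes "x \<in> carrier R" "a \<in> carrier R" "a \<noteq> \<zero>" "b \<in> carrier R"
  shows "[ \<one>, \<ominus> x ] \<otimes>\<^bsub>poly_ring R\<^esub> [ a, b ] = [ a, b \<ominus> x \<otimes> a, \<ominus> (x \<otimes> b) ]"
  using assms by (simp add: univ_poly_mult l_minus minus_eq)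

lemma linear_mult_quadratic:
  assumes "x \<in> carrier R" "a \<in> carrier R" "a \<noteq> \<zero>" "b \<in> carrier R" "c \<in> carrier R"
  shows "[ \<one>, \<ominus> x ] \<otimes>\<^bsub>poly_ring R\<^esub> [ a, b, c ] = [ a, b \<ominus> x \<otimes> a, c \<ominus> x \<otimes> b, \<ominus> (x \<otimes> c) ]"
  using assms by (simp add: univ_poly_mult l_minus minus_eq)

text \<open>Peel off three roots; the remaining constant is the leading coefficient. The
  right-nested product can be evaluated one linear factor at a time.\<close>

lemma splitted_cubic_iff:
  assumes "a \<in> carrier R" "a \<noteq> \<zero>" "b \<in> carrier R" "c \<in> carrier R" "d \<in> carrier R"
  shows "splitted [ a, b, c, d ] \<longleftrightarrow> (\<exists>x\<in>carrier R. \<exists>y\<in>carrier R. \<exists>z\<in>carrier R.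
      [ a, b, c, d ] = [ \<one>, \<ominus> x ] \<otimes>\<^bsub>poly_ring R\<^esub> ([ \<one>, \<ominus> y ] \<otimes>\<^bsub>poly_ring R\<^esub> ([ \<one>, \<ominus> z ] \<otimes>\<^bsub>poly_ring R\<^esub> [ a ])))"
    (is "_ \<longleftrightarrow> ?rhs")
proof
  assume s: "splitted [ a, b, c, d ]"
  have abcd: "[ a, b, c, d ] \<in> carrier (poly_ring R)"
    using assms by (simp add: univ_poly_carrier[symmetric] polynomial_def)
  have deg: "length [ a, b, c, d ] - 1 = Suc 2"
    by simp
  obtain x r where x: "x \<in> carrier R" and r: "r \<in> carrier (poly_ring R)" "r \<noteq> []" "splitted r" "length r - 1 = 2"
    and xr: "[ a, b, c, d ] = [ \<one>, \<ominus> x ] \<otimes>\<^bsub>poly_ring R\<^esub> r"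
    using linear_factor_of_splitted[OF abcd _ s deg] by blast
  have deg: "length r - 1 = Suc 1"
    using r by simp
  obtain y q where y: "y \<in> carrier R" and q: "q \<in> carrier (poly_ring R)" "q \<noteq> []" "splitted q" "length q - 1 = 1"
    and yq: "r = [ \<one>, \<ominus> y ] \<otimes>\<^bsub>poly_ring R\<^esub> q"
    using linear_factor_of_splitted[OF r(1-3) deg] by blast
  have deg: "length q - 1 = Suc 0"
    using q by simp
  obtain z k where z: "z \<in> carrier R" and k: "k \<in> carrier (poly_ring R)" "k \<noteq> []" "length k - 1 = 0"
    and zk: "q = [ \<one>, \<ominus> z ] \<otimes>\<^bsub>poly_ring R\<^esub> k"
    using linear_factor_of_splitted[OF q(1-3) deg] by blast
  obtain e where e: "k = [ e ]"
    using k by (cases k) auto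
  have ec: "e \<in> carrier R" "e \<noteq> \<zero>"
    using k by (auto simp: e univ_poly_carrier[symmetric] polynomial_def)
  have "a = e"
    using xr unfolding yq zk e
    by (simp add: linear_mult_const linear_mult_linear linear_mult_quadratic x y z ec)
  thus ?rhs
    using x y z xr unfolding yq zk e by blast
next
  assume ?rhs
  then obtain x y z where x: "x \<in> carrier R" "y \<in> carrier R" "z \<in> carrier R"
    and eq: "[ a, b, c, d ] = [ \<one>, \<ominus> x ] \<otimes>\<^bsub>poly_ring R\<^esub> ([ \<one>, \<ominus> y ] \<otimes>\<^bsub>poly_ring R\<^esub> ([ \<one>, \<ominus> z ] \<otimes>\<^bsub>poly_ring R\<^esub> [ a ]))"
    by blast
  have carr: "[ a ] \<in> carrier (poly_ring R)" "[ a, \<ominus> (z \<otimes> a) ] \<in> carrier (poly_ring R)"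
    "[ a, \<ominus> (z \<otimes> a) \<ominus> y \<otimes> a, \<ominus> (y \<otimes> \<ominus> (z \<otimes> a)) ] \<in> carrier (poly_ring R)"
    using assms x by (auto simp: univ_poly_carrier[symmetric] polynomial_def)
  have "splitted [ a ]"
    using carr(1) by (rule degree_zero_imp_splitted) simp
  hence "splitted [ a, \<ominus> (z \<otimes> a) ]"
    using splitted_linear_mult[OF x(3) carr(1)] assms x by (simp add: linear_mult_const)
  hence "splitted [ a, \<ominus> (z \<otimes> a) \<ominus> y \<otimes> a, \<ominus> (y \<otimes> \<ominus> (z \<otimes> a)) ]"
    using splitted_linear_mult[OF x(2) carr(2)] assms x by (simp add: linear_mult_linear)
  thus "splitted [ a, b, c, d ]"
    unfolding eq using splitted_linear_mult[OF x(1) carr(3)] assms x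
    by (simp add: linear_mult_const linear_mult_linear)
qed

end

section \<open>The list of candidates\<close>

lemma poly_degree_3_eq:
  assumes "Polynomial.degree f = 3"
  shows "f = [:Polynomial.coeff f 0, Polynomial.coeff f 1, Polynomial.coeff f 2, Polynomial.coeff f 3:]"
proof (rule poly_eqI)
  fix n
  show "Polynomial.coeff f n =
    Polynomial.coeff [:Polynomial.coeff f 0, Polynomial.coeff f 1, Polynomial.coeff f 2, Polynomial.coeff f 3:] n"
    using coeff_eq_0[of f n] assms
    by (auto simp: coeff_pCons numeral_2_eq_2 numeral_3_eq_3 split: nat.splits)
qed

lemma finite_candidates: "finite candidates"
proof -
  \<comment> \<open>Mignotte's bound gives coefficients of absolute value at most 3 times 8.5, that
    is 25.5, which lies inside this range.\<close>
  let ?I = "{-30..30} :: int set"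
  have "candidates \<subseteq> (\<lambda>(a, b, c, d). [:a, b, c, d:]) ` (?I \<times> ?I \<times> ?I \<times> ?I)"
  proof
    fix f assume "f \<in> candidates"
    hence deg: "Polynomial.degree f = 3" and M: "mahler_measure f \<le> 8.5"
      by (auto simp: candidates_def)
    have "Polynomial.coeff f k \<in> ?I" if "k \<in> {0, 1, 2, 3}" for k
    proof -
      have "real (3 choose k) \<le> 3"
        using that by (auto simp: eval_nat_numeral)
      hence "real (3 choose k) * mahler_measure f \<le> 3 * 8.5"
        using M mahler_measure_ge_0 by (intro mult_mono) auto
      hence "real_of_int \<bar>Polynomial.coeff f k\<bar> \<le> 25.5"
        using Mignotte_bound[of f k] deg by simp
      thus ?thesis by auto
    qed
    thus "f \<in> (\<lambda>(a, b, c, d). [:a, b, c, d:]) ` (?I \<times> ?I \<times> ?I \<times> ?I)"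
      using poly_degree_3_eq[OF deg] by (intro image_eqI[where x = "(Polynomial.coeff f 0, Polynomial.coeff f 1, Polynomial.coeff f 2, Polynomial.coeff f 3)"]) auto
  qed
  thus ?thesis
    by (rule finite_subset) auto
qed

lemma candidate_list_exists: "\<exists>L. candidate_list L"
proof -
  obtain L where "set L = candidates" "distinct L"
    using finite_distinct_list[OF finite_candidates] by blast
  hence "candidate_list (sort_key mahler_measure L)"
    using sorted_sort_key[of mahler_measure L] by (simp add: candidate_list_def sorted_map)
  thus ?thesis ..
qed


section \<open>Minimal polynomials\<close>

text \<open>Otherwise the two polynomials are coprime over the integers, hence over the rationals,
  and a Bezout identity evaluated at \<alpha> reads 0 = 1.\<close>

lemma irreducible_dvd_of_common_root:
  fixes f g :: "int poly" and \<alpha> :: complex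
  assumes irr: "irreducible f" and f: "poly (map_poly of_int f) \<alpha> = 0" and g: "poly (map_poly of_int g) \<alpha> = 0"
  shows "f dvd g"
proof (rule ccontr)
  assume "\<not> f dvd g"
  hence "gcd f g = 1"
    using irr by (metis dvd_trans gcd_dvd1 gcd_dvd2 irreducible_altdef is_unit_gcd_iff)
  hence "gcd (map_poly rat_of_int f) (map_poly rat_of_int g) = 1"
    by (simp add: gcd_rat_to_gcd_int)
  then obtain s t where st: "s * map_poly rat_of_int f + t * map_poly rat_of_int g = 1"
    using bezout_coefficients_fst_snd by metis
  interpret of_rat_poly: map_poly_comm_ring_hom "of_rat :: rat \<Rightarrow> complex"
    by unfold_locales (auto simp: of_rat_add of_rat_mult)
  have eq: "map_poly (of_rat :: rat \<Rightarrow> complex) (s * map_poly rat_of_int f + t * map_poly rat_of_int g) =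
     map_poly of_rat s * map_poly of_int f + map_poly of_rat t * map_poly of_int g"
    by (simp add: of_rat_poly.hom_add of_rat_poly.hom_mult map_poly_map_poly o_def)
  show False
    using arg_cong[OF eq[unfolded st], of "\<lambda>P. poly P \<alpha>"] by (simp add: f g)
qed

lemma degree_pos_of_root:
  assumes "f \<noteq> 0" "poly (map_poly of_int f) (\<alpha> :: complex) = 0"
  shows "Polynomial.degree f > 0"
proof (rule ccontr)
  assume "\<not> Polynomial.degree f > 0"
  then obtain c where "f = [:c:]"
    using degree_eq_zeroE by auto
  thus False using assms by auto
qed

text \<open>Resolves the definite description: a competitor is a multiple of \<open>f\<close> of no
  larger degree, so a constant multiple, and primitivity and sign make the constant 1.\<close>

lemma min_int_poly_eqI:
  assumes irr: "irreducible f" and lc: "lead_coeff f > 0" and f: "poly (map_poly of_int f) \<alpha> = 0"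
  shows "min_int_poly \<alpha> = f"
  unfolding min_int_poly_def
proof (rule the_equality)
  have f0: "f \<noteq> 0"
    using irr by auto
  have deg: "Polynomial.degree f > 0"
    using degree_pos_of_root[OF f0 f] .
  have content: "content f = 1"
    using irreducible_imp_primitive[OF irr] deg by simp
  have min: "Polynomial.degree f \<le> Polynomial.degree g"
    if "g \<noteq> 0" "poly (map_poly of_int g) \<alpha> = 0" for g
    using irreducible_dvd_of_common_root[OF irr f that(2)] that(1) dvd_imp_degree_le by blast
  show "content f = 1 \<and> lead_coeff f > 0 \<and> poly (map_poly of_int f) \<alpha> = 0 \<and>
    (\<forall>g. g \<noteq> 0 \<and> poly (map_poly of_int g) \<alpha> = 0 \<longrightarrow> Polynomial.degree f \<le> Polynomial.degree g)"
    using content lc f min by blast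
  fix g
  assume g: "content g = 1 \<and> lead_coeff g > 0 \<and> poly (map_poly of_int g) \<alpha> = 0 \<and>
    (\<forall>h. h \<noteq> 0 \<and> poly (map_poly of_int h) \<alpha> = 0 \<longrightarrow> Polynomial.degree g \<le> Polynomial.degree h)"
  hence g0: "g \<noteq> 0" by auto
  obtain h where h: "g = f * h"
    using irreducible_dvd_of_common_root[OF irr f] g by blast
  have "Polynomial.degree g \<le> Polynomial.degree f"
    using g f0 f by blast
  hence "Polynomial.degree h = 0"
    using g0 by (auto simp: h degree_mult_eq)
  then obtain c where c: "h = [:c:]"
    using degree_eq_zeroE by auto
  have "g = smult c f"
    by (simp add: h c)
  hence "\<bar>c\<bar> = 1" "c > 0"
    using g content lc by (auto simp: zero_less_mult_iff)
  thus "g = f"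
    by (simp add: h c)
qed

text \<open>Normalise an integer polynomial of least degree vanishing at \<alpha>. In a
  factorisation into smaller degrees, one factor would vanish at \<alpha> too, against
  minimality.\<close>

lemma algebraic_imp_irreducible_min_int_poly:
  assumes "algebraic \<alpha>"
  shows "irreducible (min_int_poly \<alpha>)" "lead_coeff (min_int_poly \<alpha>) > 0"
    "poly (map_poly of_int (min_int_poly \<alpha>)) \<alpha> = 0"
proof -
  define Z where "Z = (\<lambda>f. f \<noteq> 0 \<and> poly (map_poly of_int f) \<alpha> = 0)"
  obtain P where P: "\<forall>i. Polynomial.coeff P i \<in> \<int>" "P \<noteq> 0" "poly P \<alpha> = 0"
    using assms by (auto simp: algebraic_def)
  \<comment> \<open>Reads integer coefficients back from complex ones; on integers the floor of the
    real part changes nothing.\<close>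
  define q where "q = map_poly (\<lambda>z. \<lfloor>Re z\<rfloor>) P"
  have int: "of_int \<lfloor>Re z\<rfloor> = z" if "z \<in> \<int>" for z
    using that by (elim Ints_cases) simp
  have "P = map_poly of_int q"
    by (rule poly_eqI) (use P(1) int in \<open>simp add: q_def coeff_map_poly\<close>)
  hence "Z q"
    using P by (auto simp: Z_def)
  then obtain f0 where f0: "Z f0" and min0: "\<And>g. Z g \<Longrightarrow> Polynomial.degree f0 \<le> Polynomial.degree g"
    using ex_has_least_nat[of Z q Polynomial.degree] by blast
  define f1 where "f1 = primitive_part f0"
  have f1: "f0 = smult (content f0) f1" "content f1 = 1" "f1 \<noteq> 0" "Polynomial.degree f1 = Polynomial.degree f0"
    using f0 by (auto simp: f1_def Z_def)
  have Zf1: "Z f1"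
    using f0 f1(3) unfolding Z_def
    by (subst (asm) (2) f1(1)) (auto simp: of_int_hom.map_poly_hom_smult)
  define f where "f = (if lead_coeff f1 > 0 then f1 else - f1)"
  have lc: "lead_coeff f > 0"
    using f1(3) by (auto simp: f_def not_less order.order_iff_strict)
  have f: "Z f" "content f = 1" and min: "\<And>g. Z g \<Longrightarrow> Polynomial.degree f \<le> Polynomial.degree g"
    using Zf1 f1 min0 content_smult_int[of "-1" f1] by (auto simp: f_def Z_def hom_distribs)
  have "irreducible\<^sub>d f"
  proof (rule irreducible\<^sub>dI)
    show "Polynomial.degree f > 0"
      using f(1) degree_pos_of_root unfolding Z_def by blast
    fix g h assume *: "Polynomial.degree g < Polynomial.degree f" "Polynomial.degree h < Polynomial.degree f" "f = g * h"
    have "Z g \<or> Z h"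
      using f(1) by (auto simp: Z_def *(3) hom_distribs)
    thus False
      using min * by (meson not_le)
  qed
  hence "irreducible f"
    using irreducible_primitive_connect[of f] f(2) by simp
  moreover from this have "min_int_poly \<alpha> = f"
    using lc f(1) unfolding Z_def by (intro min_int_poly_eqI) auto
  ultimately show "irreducible (min_int_poly \<alpha>)" "lead_coeff (min_int_poly \<alpha>) > 0"
    "poly (map_poly of_int (min_int_poly \<alpha>)) \<alpha> = 0"
    using lc f(1) by (auto simp: Z_def)
qed


section \<open>Irreducible cubics\<close>

lemma irreducible_degree_3_no_int_root:
  fixes f :: "int poly"
  assumes "irreducible f" "Polynomial.degree f = 3"
  shows "poly f r \<noteq> 0"
proof
  assume "poly f r = 0"
  then obtain g where g: "f = [:- r, 1:] * g"
    using poly_eq_0_iff_dvd[of f r] by (auto elim: dvdE)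
  have "g \<noteq> 0"
    using g assms(2) by auto
  hence "Polynomial.degree f = 1 + Polynomial.degree g"
    unfolding g by (subst degree_mult_eq) auto
  hence "Polynomial.degree g = 2"
    using assms(2) by simp
  moreover have "[:- r, 1:] dvd 1 \<or> g dvd 1"
    using assms(1) g by (rule irreducibleD)
  ultimately show False
    by (auto dest!: dvd_imp_degree_le)
qed

lemma cubic_has_real_root:
  fixes f :: "real poly"
  assumes "Polynomial.degree f = 3"
  obtains x where "poly f x = 0"
proof -
  have main: "\<exists>x. poly g x = 0" if deg: "Polynomial.degree g = 3" and lc: "Polynomial.coeff g 3 > 0" for g :: "real poly"
  proof -
    obtain a b c d where g: "g = [:d, c, b, a:]"
      using poly_degree_3_eq[OF deg] by blast
    have a: "a > 0"
      using lc by (simp add: g numeral_3_eq_3)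
    \<comment> \<open>Chosen so that a K^3 = (|b| + |c| + |d|)K^2 + a K^2. As K >= 1, the leading
      term outweighs the others at K and -K, and the signs there differ.\<close>
    define K where "K = (\<bar>b\<bar> + \<bar>c\<bar> + \<bar>d\<bar>) / a + 1"
    have K: "K \<ge> 1"
      using a by (simp add: K_def)
    have aK: "a * K = \<bar>b\<bar> + \<bar>c\<bar> + \<bar>d\<bar> + a"
      using a by (simp add: K_def field_simps)
    have KK: "K \<le> K * K" "1 \<le> K * K"
      using K mult_mono[of 1 K K K] mult_mono[of 1 K 1 K] by auto
    have cK: "\<bar>c * K\<bar> \<le> \<bar>c\<bar> * (K * K)"
      using K KK by (simp add: abs_mult mult_left_mono)
    have dK: "\<bar>d\<bar> \<le> \<bar>d\<bar> * (K * K)"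
      using mult_left_mono[OF KK(2), of "\<bar>d\<bar>"] by simp
    have bK: "\<bar>b * (K * K)\<bar> \<le> \<bar>b\<bar> * (K * K)"
      using K by (simp add: abs_mult)
    have "a * K * (K * K) = \<bar>b\<bar> * (K * K) + \<bar>c\<bar> * (K * K) + \<bar>d\<bar> * (K * K) + a * (K * K)"
      unfolding aK by (simp add: algebra_simps)
    moreover have "a * (K * K) > 0"
      using a K by simp
    moreover have "poly g K = d + c * K + b * (K * K) + a * K * (K * K)"
      "poly g (- K) = d - c * K + b * (K * K) - a * K * (K * K)"
      by (simp_all add: g algebra_simps)
    ultimately have "poly g (- K) < 0" "0 < poly g K"
      using abs_le_D1[OF cK] abs_le_D2[OF cK] abs_le_D1[OF dK] abs_le_D2[OF dK] abs_le_D1[OF bK] abs_le_D2[OF bK]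
      by linarith+
    thus ?thesis
      using poly_IVT_pos[of "- K" K g] K by auto
  qed
  have "Polynomial.coeff f 3 \<noteq> 0"
    using assms leading_coeff_0_iff[of f] by auto
  thus ?thesis
    using main[of f] main[of "- f"] assms that by (cases "Polynomial.coeff f 3 > 0") auto
qed

text \<open>\<open>f\<close> would divide x^n - 1, so the real root that an odd degree guarantees
  would be 1 or -1, an integer root of an irreducible cubic.\<close>

lemma cubic_root_not_root_of_unity:
  fixes f :: "int poly" and \<alpha> :: complex
  assumes irr: "irreducible f" and deg: "Polynomial.degree f = 3" and root: "poly (map_poly of_int f) \<alpha> = 0"
  shows "\<not> root_of_unity \<alpha>"
proof
  assume "root_of_unity \<alpha>"
  then obtain n where n: "n > 0" "\<alpha> ^ n = 1"
    by (auto simp: root_of_unity_def)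
  have "poly (map_poly of_int (Polynomial.monom 1 n - 1)) \<alpha> = 0"
    using n by (simp add: hom_distribs poly_monom)
  hence "f dvd Polynomial.monom 1 n - 1"
    by (rule irreducible_dvd_of_common_root[OF irr root])
  then obtain g where g: "Polynomial.monom 1 n - 1 = f * g"
    by (elim dvdE)
  have "Polynomial.degree (map_poly real_of_int f) = 3"
    using deg by simp
  then obtain x where x: "poly (map_poly real_of_int f) x = 0"
    by (rule cubic_has_real_root)
  have "poly (map_poly real_of_int (Polynomial.monom 1 n - 1)) x = 0"
    unfolding g using x by (simp add: hom_distribs)
  hence "x ^ n = 1"
    by (simp add: hom_distribs poly_monom)
  hence "\<bar>x\<bar> ^ n = 1 ^ n"
    by (simp flip: power_abs)
  hence "\<bar>x\<bar> = 1"
    by (rule power_eq_imp_eq_base) (use n(1) in auto)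
  hence "x = of_int 1 \<or> x = of_int (- 1)"
    by auto
  then obtain r :: int where r: "x = of_int r"
    by blast
  have "poly f r = 0"
    using x unfolding r by simp
  thus False
    using irreducible_degree_3_no_int_root[OF irr deg] by blast
qed

text \<open>Links the exclusion of cyclotomic polynomials in the list with the exclusion of roots of
  unity in \<open>tau\<close>.\<close>

lemma is_cyclotomic_imp_root_of_unity:
  assumes "is_cyclotomic f" "poly (map_poly of_int f) \<alpha> = 0"
  shows "root_of_unity \<alpha>"
proof -
  obtain n where n: "n > 0" "map_poly of_int f = cyclotomic_poly n"
    using assms(1) by (auto simp: is_cyclotomic_def)
  let ?S = "{\<zeta> :: complex. \<zeta> ^ n = 1 \<and> (\<forall>m. 0 < m \<and> m < n \<longrightarrow> \<zeta> ^ m \<noteq> 1)}"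
  have fin: "finite ?S"
    by (rule finite_subset[OF _ finite_roots_unity[of n]]) (use n in auto)
  have "(\<Prod>\<zeta>\<in>?S. \<alpha> - \<zeta>) = 0"
    using assms(2) unfolding n(2) cyclotomic_poly_def by (simp add: poly_prod)
  hence "\<alpha> \<in> ?S"
    using fin by (auto simp: prod_zero_iff)
  thus ?thesis
    using n(1) by (auto simp: root_of_unity_def)
qed

text \<open>A rational root \<open>r\<close> would satisfy \<open>r\<^sup>3 = m/e\<close>, against the valuations at \<open>q\<close>.\<close>

lemma irreducible_binomial_cubic:
  assumes q: "prime (q::int)" and me: "m \<noteq> 0" "e \<noteq> 0" "algebraic_semidom_class.coprime m e"
    and mult: "\<not> [multiplicity q m = multiplicity q e] (mod 3)"
  shows "irreducible [:- m, 0, 0, e:]"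
proof -
  let ?f = "[:- m, 0, 0, e:]"
  have deg: "Polynomial.degree ?f = 3"
    using me by simp
  have pe: "prime_elem q"
    using q by (rule prime_imp_prime_elem)
  have noroot: False if "e * u ^ 3 = m * v ^ 3" "v \<noteq> 0" for u v
  proof -
    have "u \<noteq> 0"
      using that me by auto
    hence "multiplicity q e + 3 * multiplicity q u = multiplicity q m + 3 * multiplicity q v"
      using arg_cong[OF that(1), of "multiplicity q"] me that(2)
      by (simp add: prime_elem_multiplicity_mult_distrib[OF pe] prime_elem_multiplicity_power_distrib[OF pe])
    hence "(multiplicity q e + 3 * multiplicity q u) mod 3 = (multiplicity q m + 3 * multiplicity q v) mod 3"
      by simp
    thus False
      using mult by (simp add: cong_def)
  qed
  have linear: False if gh: "?f = g * h" and deg1: "Polynomial.degree g = 1" for g h :: "int poly"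
  proof -
    obtain u v where g: "g = [:u, v:]" "v \<noteq> 0"
      using deg1 by (cases g rule: pCons_cases) (auto split: if_splits elim!: degree_eq_zeroE)
    have "poly (map_poly rat_of_int ?f) (- of_int u / of_int v) = 0"
      unfolding gh using g by (simp add: hom_distribs)
    moreover have "map_poly rat_of_int ?f = [:- of_int m, 0, 0, of_int e:]"
      by (rule poly_eqI) (simp add: coeff_map_poly coeff_pCons split: nat.splits)
    ultimately have "of_int e * (- of_int u) ^ 3 = (of_int (m * v ^ 3) :: rat)"
      using g(2) by (simp add: field_simps power3_eq_cube)
    hence "(of_int (e * (- u) ^ 3) :: rat) = of_int (m * v ^ 3)"
      by simp
    hence "e * (- u) ^ 3 = m * v ^ 3"
      by (simp only: of_int_eq_iff)
    thus False
      using noroot g(2) by blast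
  qed
  have "content ?f = 1"
    using me by (simp add: content_def cCons_def coprime_iff_gcd_eq_1)
  moreover have "irreducible\<^sub>d ?f"
  proof (rule irreducible\<^sub>dI)
    fix g h assume *: "Polynomial.degree g > 0" "Polynomial.degree h > 0" "?f = g * h"
    hence "Polynomial.degree ?f = Polynomial.degree g + Polynomial.degree h"
      by (simp only: *(3)) (rule degree_mult_eq; auto)
    hence "Polynomial.degree g + Polynomial.degree h = 3"
      using deg by simp
    hence "Polynomial.degree g = 1 \<or> Polynomial.degree h = 1"
      using * by linarith
    thus False
      using linear[of g h] linear[of h g] * by (auto simp: mult.commute)
  qed (use deg in simp)
  ultimately show ?thesis
    using irreducible_primitive_connect[of ?f] by simp
qed

section \<open>Correctness of the algorithm\<close>

context padic
begin

lemma null_scale_iff: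
  assumes "k \<noteq> 0"
  shows "(\<lambda>n. k * x n) \<in> padic_null p \<longleftrightarrow> x \<in> padic_null p"
proof
  assume "(\<lambda>n. k * x n) \<in> padic_null p"
  from null_divide_const[OF this, of k] show "x \<in> padic_null p"
    using assms by simp
qed (intro null_mult_left Cauchy_const)

text \<open>Vieta's formulas: compare coefficients with those of a(X - x)(X - y)(X - z) and divide
  by the leading coefficient.\<close>

lemma splits_over_Qp_cubic_iff:
  fixes f :: "int poly"
  assumes deg: "Polynomial.degree f = 3"
  defines "a \<equiv> of_int (Polynomial.coeff f 3) :: rat" and "b \<equiv> of_int (Polynomial.coeff f 2)"
    and "c \<equiv> of_int (Polynomial.coeff f 1)" and "d \<equiv> of_int (Polynomial.coeff f 0)"
  shows "splits_over_Qp p f \<longleftrightarrow> (\<exists>x y z. padic_Cauchy p x \<and> padic_Cauchy p y \<and> padic_Cauchy p z \<and>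
      (\<lambda>n. b / a + (x n + y n + z n)) \<in> padic_null p \<and>
      (\<lambda>n. c / a - (x n * y n + x n * z n + y n * z n)) \<in> padic_null p \<and>
      (\<lambda>n. d / a + x n * y n * z n) \<in> padic_null p)"
proof -
  have a: "a \<noteq> 0"
    using deg leading_coeff_0_iff[of f] by (auto simp: a_def)
  hence a': "cls (\<lambda>n. a) \<noteq> \<zero>\<^bsub>Qp p\<^esub>"
    by (simp add: cls_0 cls_eq_iff Cauchy_const null_const_iff)
  have "f \<noteq> 0"
    using deg by auto
  hence "rev (coeffs f) = map (Polynomial.coeff f) [3, 2, 1, 0]"
    using deg by (simp add: coeffs_def numeral_3_eq_3 numeral_2_eq_2)
  hence "splits_over_Qp p f \<longleftrightarrow> Q.splitted [cls (\<lambda>n. a), cls (\<lambda>n. b), cls (\<lambda>n. c), cls (\<lambda>n. d)]"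
    by (simp add: splits_over_Qp_def Qp_of_rat_eq_cls a_def b_def c_def d_def)
  also have "\<dots> \<longleftrightarrow> (\<exists>x\<in>carrier (Qp p). \<exists>y\<in>carrier (Qp p). \<exists>z\<in>carrier (Qp p).
      [cls (\<lambda>n. a), cls (\<lambda>n. b), cls (\<lambda>n. c), cls (\<lambda>n. d)] =
      [\<one>\<^bsub>Qp p\<^esub>, \<ominus>\<^bsub>Qp p\<^esub> x] \<otimes>\<^bsub>poly_ring (Qp p)\<^esub> ([\<one>\<^bsub>Qp p\<^esub>, \<ominus>\<^bsub>Qp p\<^esub> y] \<otimes>\<^bsub>poly_ring (Qp p)\<^esub>
        ([\<one>\<^bsub>Qp p\<^esub>, \<ominus>\<^bsub>Qp p\<^esub> z] \<otimes>\<^bsub>poly_ring (Qp p)\<^esub> [cls (\<lambda>n. a)])))"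
    by (intro Q.splitted_cubic_iff cls_in_carrier Cauchy_const a')
  also have "\<dots> \<longleftrightarrow> (\<exists>x y z. padic_Cauchy p x \<and> padic_Cauchy p y \<and> padic_Cauchy p z \<and>
      [cls (\<lambda>n. a), cls (\<lambda>n. b), cls (\<lambda>n. c), cls (\<lambda>n. d)] =
      [\<one>\<^bsub>Qp p\<^esub>, \<ominus>\<^bsub>Qp p\<^esub> cls x] \<otimes>\<^bsub>poly_ring (Qp p)\<^esub> ([\<one>\<^bsub>Qp p\<^esub>, \<ominus>\<^bsub>Qp p\<^esub> cls y] \<otimes>\<^bsub>poly_ring (Qp p)\<^esub>
        ([\<one>\<^bsub>Qp p\<^esub>, \<ominus>\<^bsub>Qp p\<^esub> cls z] \<otimes>\<^bsub>poly_ring (Qp p)\<^esub> [cls (\<lambda>n. a)])))"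
    unfolding carrier_Qp by blast
  also have "\<dots> \<longleftrightarrow> (\<exists>x y z. padic_Cauchy p x \<and> padic_Cauchy p y \<and> padic_Cauchy p z \<and>
      (\<lambda>n. b / a + (x n + y n + z n)) \<in> padic_null p \<and>
      (\<lambda>n. c / a - (x n * y n + x n * z n + y n * z n)) \<in> padic_null p \<and>
      (\<lambda>n. d / a + x n * y n * z n) \<in> padic_null p)"
  proof (intro ex_cong1 conj_cong refl)
    fix x y z assume xyz: "padic_Cauchy p x" "padic_Cauchy p y" "padic_Cauchy p z"
    \<comment> \<open>The left sides are the coefficient differences in the form in which the list
      products evaluate; the right sides extract the factor \<open>a\<close>.\<close>
    have b: "(\<lambda>n. b - (- (z n * a) - y n * a - x n * a)) = (\<lambda>n. a * (b / a + (x n + y n + z n)))"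
      and c: "(\<lambda>n. c - (- (y n * - (z n * a)) - x n * (- (z n * a) - y n * a))) =
        (\<lambda>n. a * (c / a - (x n * y n + x n * z n + y n * z n)))"
      and d: "(\<lambda>n. d - (- (x n * - (y n * - (z n * a))))) = (\<lambda>n. a * (d / a + x n * y n * z n))"
      using a by (simp_all add: fun_eq_iff algebra_simps)
    have prod: "[\<one>\<^bsub>Qp p\<^esub>, \<ominus>\<^bsub>Qp p\<^esub> cls x] \<otimes>\<^bsub>poly_ring (Qp p)\<^esub> ([\<one>\<^bsub>Qp p\<^esub>, \<ominus>\<^bsub>Qp p\<^esub> cls y] \<otimes>\<^bsub>poly_ring (Qp p)\<^esub>
        ([\<one>\<^bsub>Qp p\<^esub>, \<ominus>\<^bsub>Qp p\<^esub> cls z] \<otimes>\<^bsub>poly_ring (Qp p)\<^esub> [cls (\<lambda>n. a)])) =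
      [cls (\<lambda>n. a), cls (\<lambda>n. - (z n * a) - y n * a - x n * a),
       cls (\<lambda>n. - (y n * - (z n * a)) - x n * (- (z n * a) - y n * a)), cls (\<lambda>n. - (x n * - (y n * - (z n * a))))]"
      using xyz a'
      by (simp add: Q.linear_mult_const Q.linear_mult_linear Q.linear_mult_quadratic cls_in_carrier Cauchy_intros)
        (simp add: cls_mult cls_uminus cls_add a_minus_def Cauchy_intros)
    have eq: "[cls (\<lambda>n. a), cls (\<lambda>n. b), cls (\<lambda>n. c), cls (\<lambda>n. d)] =
      [cls (\<lambda>n. a), cls (\<lambda>n. - (z n * a) - y n * a - x n * a),
       cls (\<lambda>n. - (y n * - (z n * a)) - x n * (- (z n * a) - y n * a)), cls (\<lambda>n. - (x n * - (y n * - (z n * a))))] \<longleftrightarrow>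
      (\<lambda>n. b - (- (z n * a) - y n * a - x n * a)) \<in> padic_null p \<and>
      (\<lambda>n. c - (- (y n * - (z n * a)) - x n * (- (z n * a) - y n * a))) \<in> padic_null p \<and>
      (\<lambda>n. d - (- (x n * - (y n * - (z n * a))))) \<in> padic_null p"
      using xyz by (simp only: list.inject cls_eq_iff Cauchy_intros) (simp add: null_0)
    show "[cls (\<lambda>n. a), cls (\<lambda>n. b), cls (\<lambda>n. c), cls (\<lambda>n. d)] =
      [\<one>\<^bsub>Qp p\<^esub>, \<ominus>\<^bsub>Qp p\<^esub> cls x] \<otimes>\<^bsub>poly_ring (Qp p)\<^esub> ([\<one>\<^bsub>Qp p\<^esub>, \<ominus>\<^bsub>Qp p\<^esub> cls y] \<otimes>\<^bsub>poly_ring (Qp p)\<^esub>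
        ([\<one>\<^bsub>Qp p\<^esub>, \<ominus>\<^bsub>Qp p\<^esub> cls z] \<otimes>\<^bsub>poly_ring (Qp p)\<^esub> [cls (\<lambda>n. a)])) \<longleftrightarrow>
      (\<lambda>n. b / a + (x n + y n + z n)) \<in> padic_null p \<and>
      (\<lambda>n. c / a - (x n * y n + x n * z n + y n * z n)) \<in> padic_null p \<and>
      (\<lambda>n. d / a + x n * y n * z n) \<in> padic_null p"
      unfolding prod eq unfolding b c d null_scale_iff[OF a] ..
  qed
  finally show ?thesis .
qed

text \<open>Candidates occur with both signs, minimal polynomials only with positive leading
  coefficient; Vieta's quotients ignore the sign.\<close>

lemma splits_over_Qp_uminus:
  assumes "Polynomial.degree f = 3"
  shows "splits_over_Qp p (- f) \<longleftrightarrow> splits_over_Qp p f"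
  using assms by (simp add: splits_over_Qp_cubic_iff)

lemma depressed_A_eq:
  fixes f :: "int poly"
  assumes "Polynomial.degree f = 3"
  defines "a \<equiv> of_int (Polynomial.coeff f 3) :: rat" and "b \<equiv> of_int (Polynomial.coeff f 2)"
    and "c \<equiv> of_int (Polynomial.coeff f 1)"
  shows "depressed_A f = c / a - (b / a) ^ 2 / 3"
proof -
  have "a \<noteq> 0"
    using assms(1) leading_coeff_0_iff[of f] by (auto simp: a_def)
  thus ?thesis
    unfolding depressed_A_def Let_def a_def[symmetric] b_def[symmetric] c_def[symmetric]
    by (simp add: field_simps power2_eq_square)
qed

lemma depressed_B_eq:
  fixes f :: "int poly"
  assumes "Polynomial.degree f = 3"
  defines "a \<equiv> of_int (Polynomial.coeff f 3) :: rat" and "b \<equiv> of_int (Polynomial.coeff f 2)"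
    and "c \<equiv> of_int (Polynomial.coeff f 1)" and "d \<equiv> of_int (Polynomial.coeff f 0)"
  shows "depressed_B f = d / a - (b / a) * (c / a) / 3 + 2 * (b / a) ^ 3 / 27"
proof -
  have "a \<noteq> 0"
    using assms(1) leading_coeff_0_iff[of f] by (auto simp: a_def)
  thus ?thesis
    unfolding depressed_B_def Let_def a_def[symmetric] b_def[symmetric] c_def[symmetric] d_def[symmetric]
    by (simp add: field_simps power2_eq_square power3_eq_cube)
qed

section \<open>The search along the sorted list\<close>

definition passes :: "(int poly \<Rightarrow> (nat \<Rightarrow> rat) set) \<Rightarrow> int poly \<Rightarrow> bool" where
  "passes s f \<longleftrightarrow> is_power_in (Qp p) 2 (Qp_of_rat p (depressed_Delta f)) \<and>
     is_power_in (Qp p) 3 (cardano_cube p s f)"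

lemma cubic_search_eq_first:
  assumes "\<exists>f\<in>set L. passes s f" "sorted_wrt (\<lambda>f g. mahler_measure f \<le> mahler_measure g) L"
  shows "\<exists>f\<in>set L. passes s f \<and> cubic_search p s L = Some (1 / 3 * ln (mahler_measure f)) \<and>
           (\<forall>g\<in>set L. passes s g \<longrightarrow> mahler_measure f \<le> mahler_measure g)"
  using assms
proof (induction L)
  case (Cons f L)
  show ?case
  proof (cases "passes s f")
    case True
    thus ?thesis
      using Cons.prems by (auto simp: passes_def)
  next
    case False
    moreover from this have "cubic_search p s (f # L) = cubic_search p s L"
      by (auto simp: passes_def)
    ultimately show ?thesis
      using Cons by auto
  qed
qed simp

text \<open>Merges the two cases for C: for A = 0, the prescribed -B is also a square root of the
  discriminant. The conclusions are the premises on \<open>c\<close> of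
  \<open>cube_imp_resolvents\<close> and \<open>resolvents_imp_cube\<close>.\<close>

lemma cardano_C_representative:
  assumes s: "sqrt_choice p s" and sq: "is_power_in (Qp p) 2 (Qp_of_rat p (depressed_Delta f))"
  shows "\<exists>c. padic_Cauchy p c \<and>
    (\<lambda>n. c n ^ 2 - (depressed_B f ^ 2 + 4 * depressed_A f ^ 3 / 27)) \<in> padic_null p \<and>
    (depressed_A f = 0 \<longrightarrow> (\<lambda>n. c n + depressed_B f) \<in> padic_null p) \<and>
    cardano_cube p s f = cls (\<lambda>n. (- depressed_B f + c n) / 2)"
proof -
  have cube: "cardano_cube p s f = cls (\<lambda>n. (- depressed_B f + c n) / 2)"
    if "padic_Cauchy p c" "cardano_C p s f = cls c" for c
    using that by (simp add: cardano_cube_def inv_Qp_of_rat) (simp add: Qp_of_rat_eq_cls cls_add cls_mult Cauchy_intros)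
  show ?thesis
  proof (cases "depressed_A f = 0")
    case True
    show ?thesis
    proof (intro exI[of _ "\<lambda>n. - depressed_B f"] conjI impI)
      show "cardano_cube p s f = cls (\<lambda>n. (- depressed_B f + - depressed_B f) / 2)"
        using True by (intro cube Cauchy_const) (simp add: cardano_C_def Qp_of_rat_eq_cls)
    qed (use True in \<open>auto simp: null_0 Cauchy_const\<close>)
  next
    case False
    have C: "cardano_C p s f = s f"
      using False by (simp add: cardano_C_def)
    have sf: "s f \<in> carrier (Qp p)" "s f [^]\<^bsub>Qp p\<^esub> (2::nat) = Qp_of_rat p (depressed_Delta f)"
      using s sq by (auto simp: sqrt_choice_def)
    obtain c where c: "padic_Cauchy p c" "s f = cls c"
      using carrier_Qp_imp_cls[OF sf(1)] by blast
    show ?thesis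
    proof (intro exI[of _ c] conjI impI)
      show "(\<lambda>n. c n ^ 2 - (depressed_B f ^ 2 + 4 * depressed_A f ^ 3 / 27)) \<in> padic_null p"
        using sf(2) c by (simp add: cls_power Qp_of_rat_eq_cls cls_eq_iff Cauchy_intros depressed_Delta_def)
    qed (use False C c cube in auto)
  qed
qed

end

context padic_1_mod_3
begin

text \<open>Both directions go through the resolvents u and v, which on one side yield the roots and
  on the other the square root and the cube root.\<close>

lemma passes_iff_splits:
  assumes s: "sqrt_choice p s" and deg: "Polynomial.degree f = 3"
  shows "passes s f \<longleftrightarrow> splits_over_Qp p f"
proof
  note AB = depressed_A_eq[OF deg] depressed_B_eq[OF deg]
  obtain w where w: "padic_Cauchy p w" "(\<lambda>n. w n ^ 2 + w n + 1) \<in> padic_null p"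
    by (rule Cauchy_cube_root_of_unity)
  {
    assume "passes s f"
    hence sq: "is_power_in (Qp p) 2 (Qp_of_rat p (depressed_Delta f))"
      and cube: "is_power_in (Qp p) 3 (cardano_cube p s f)"
      by (auto simp: passes_def)
    obtain c where c: "padic_Cauchy p c"
      "(\<lambda>n. c n ^ 2 - (depressed_B f ^ 2 + 4 * depressed_A f ^ 3 / 27)) \<in> padic_null p"
      "depressed_A f = 0 \<Longrightarrow> (\<lambda>n. c n + depressed_B f) \<in> padic_null p"
      and cc: "cardano_cube p s f = cls (\<lambda>n. (- depressed_B f + c n) / 2)"
      using cardano_C_representative[OF s sq] by blast
    obtain t where t: "padic_Cauchy p t" "(\<lambda>n. t n ^ 3 - (- depressed_B f + c n) / 2) \<in> padic_null p"
      using cube c(1) unfolding cc by (auto simp: is_power_in_Qp_cls_iff Cauchy_intros)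
    obtain u v where uv: "padic_Cauchy p u" "padic_Cauchy p v"
      "(\<lambda>n. depressed_A f + 3 * u n * v n) \<in> padic_null p"
      "(\<lambda>n. depressed_B f + (u n ^ 3 + v n ^ 3)) \<in> padic_null p"
      by (rule cube_imp_resolvents[OF c t])
    show "splits_over_Qp p f"
      unfolding splits_over_Qp_cubic_iff[OF deg]
      by (rule resolvents_imp_roots[OF w uv[unfolded AB]]) blast
  }
  {
    assume "splits_over_Qp p f"
    then obtain x y z where xyz: "padic_Cauchy p x" "padic_Cauchy p y" "padic_Cauchy p z"
      "(\<lambda>n. of_int (Polynomial.coeff f 2) / of_int (Polynomial.coeff f 3) + (x n + y n + z n)) \<in> padic_null p"
      "(\<lambda>n. of_int (Polynomial.coeff f 1) / of_int (Polynomial.coeff f 3) - (x n * y n + x n * z n + y n * z n)) \<in> padic_null p"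
      "(\<lambda>n. of_int (Polynomial.coeff f 0) / of_int (Polynomial.coeff f 3) + x n * y n * z n) \<in> padic_null p"
      unfolding splits_over_Qp_cubic_iff[OF deg] by blast
    obtain u v where uv: "padic_Cauchy p u" "padic_Cauchy p v"
      "(\<lambda>n. depressed_A f + 3 * u n * v n) \<in> padic_null p"
      "(\<lambda>n. depressed_B f + (u n ^ 3 + v n ^ 3)) \<in> padic_null p"
      unfolding AB by (rule roots_imp_resolvents[OF w xyz])
    have "(\<lambda>n. (u n ^ 3 - v n ^ 3) ^ 2 - depressed_Delta f) \<in> padic_null p"
      using resolvents_discriminant[OF uv] by (simp add: depressed_Delta_def)
    hence sq: "is_power_in (Qp p) 2 (Qp_of_rat p (depressed_Delta f))"
      unfolding Qp_of_rat_eq_cls is_power_in_Qp_cls_iff[OF Cauchy_const]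
      by (intro exI[of _ "\<lambda>n. u n ^ 3 - v n ^ 3"] conjI Cauchy_intros uv)
    obtain c where c: "padic_Cauchy p c"
      "(\<lambda>n. c n ^ 2 - (depressed_B f ^ 2 + 4 * depressed_A f ^ 3 / 27)) \<in> padic_null p"
      and "depressed_A f = 0 \<Longrightarrow> (\<lambda>n. c n + depressed_B f) \<in> padic_null p"
      and cc: "cardano_cube p s f = cls (\<lambda>n. (- depressed_B f + c n) / 2)"
      using cardano_C_representative[OF s sq] by blast
    have "is_power_in (Qp p) 3 (cardano_cube p s f)"
      unfolding cc using c(1) resolvents_imp_cube[OF uv c]
      by (simp add: is_power_in_Qp_cls_iff Cauchy_intros)
    thus "passes s f"
      using sq by (simp add: passes_def)
  }
qed

section \<open>A candidate that passes\<close>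

lemma passes_binomial_cubic:
  assumes e: "e \<noteq> 0" and cube: "is_power_in (Qp p) 3 (Qp_of_rat p (of_int m / of_int e))"
  shows "passes s [:- m, 0, 0, e:]"
proof -
  let ?f = "[:- m, 0, 0, e:]"
  have coeffs: "Polynomial.coeff ?f 3 = e" "Polynomial.coeff ?f 2 = 0" "Polynomial.coeff ?f 1 = 0" "Polynomial.coeff ?f 0 = - m"
    by (simp_all add: numeral_3_eq_3 numeral_2_eq_2)
  \<comment> \<open>With A = 0 the discriminant is the square B^2, and C = -B makes -B = m/e the
    element tested for being a cube.\<close>
  have A: "depressed_A ?f = 0"
    unfolding depressed_A_def coeffs by simp
  have B: "depressed_B ?f = - (of_int m / of_int e)"
    unfolding depressed_B_def coeffs using e by (simp add: field_simps power2_eq_square power3_eq_cube)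
  have "is_power_in (Qp p) 2 (Qp_of_rat p (depressed_Delta ?f))"
    unfolding depressed_Delta_def A Qp_of_rat_eq_cls is_power_in_Qp_cls_iff[OF Cauchy_const]
    by (intro exI[of _ "\<lambda>n. depressed_B ?f"]) (simp add: Cauchy_const null_0)
  moreover have "cardano_cube p s ?f = Qp_of_rat p (of_int m / of_int e)"
    unfolding cardano_cube_def cardano_C_def A B
    by (simp add: inv_Qp_of_rat) (simp add: Qp_of_rat_eq_cls cls_add cls_mult Cauchy_intros)
  ultimately show ?thesis
    using cube by (simp add: passes_def)
qed

text \<open>Landau's inequality bounds the Mahler measure by the root of the sum of squared
  coefficients, here at most 8.\<close>

lemma candidate_binomial_cubic:
  assumes "prime (q::int)" "m \<noteq> 0" "e \<noteq> 0" "algebraic_semidom_class.coprime m e"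
    "\<not> [multiplicity q m = multiplicity q e] (mod 3)" "m ^ 2 + e ^ 2 \<le> 64"
  shows "[:- m, 0, 0, e:] \<in> candidates"
proof -
  let ?f = "[:- m, 0, 0, e:]"
  have irr: "irreducible ?f"
    using irreducible_binomial_cubic assms(1-5) by blast
  have deg: "Polynomial.degree ?f = 3"
    using assms by simp
  have "\<not> constant (poly (map_poly complex_of_int ?f))"
    using deg by (simp add: constant_degree)
  then obtain \<alpha> :: complex where root: "poly (map_poly of_int ?f) \<alpha> = 0"
    using fundamental_theorem_of_algebra by blast
  have "\<not> is_cyclotomic ?f"
    using is_cyclotomic_imp_root_of_unity[OF _ root] cubic_root_not_root_of_unity[OF irr deg root] by blast
  moreover have "mahler_measure ?f \<le> 8.5"
  proof -
    have "mahler_measure ?f \<le> sqrt (real_of_int (\<Sum>a\<leftarrow>coeffs ?f. a * a))"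
      by (rule Landau_inequality_mahler_measure)
    also have "(\<Sum>a\<leftarrow>coeffs ?f. a * a) = m ^ 2 + e ^ 2"
      using assms by (simp add: power2_eq_square cCons_def)
    also have "sqrt (real_of_int (m ^ 2 + e ^ 2)) \<le> sqrt (real_of_int 64)"
      using assms(6) by (simp only: real_sqrt_le_iff of_int_le_iff)
    also have "\<dots> = 8"
      by (rule real_sqrt_unique) auto
    finally show ?thesis by simp
  qed
  ultimately show ?thesis
    using irr deg by (simp add: candidates_def)
qed

lemma some_candidate_passes: "\<exists>f\<in>candidates. passes s f"
proof -
  obtain x :: int and a where xa: "int p dvd x ^ 3 - a" and a: "a \<in> {2, 3, 6, 12}"
    by (rule some_cube_mod_p)
  have cube: "is_power_in (Qp p) 3 (Qp_of_rat p (of_int a))"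
    using is_cube_of_int[OF xa] a by auto
  have p2: "prime (2::int)" and p3: "prime (3::int)"
    by simp_all
  have m6: "multiplicity 2 (6::int) = 1"
    using multiplicity_times_same[of "3::int" 2] by (simp add: not_dvd_imp_multiplicity_0)
  consider "a = 2" | "a = 3" | "a = 6" | "a = 12"
    using a by auto
  thus ?thesis
  proof cases
    case 1
    show ?thesis
    proof (rule bexI)
      show "passes s [:- 2, 0, 0, 1:]"
        using passes_binomial_cubic[of 1 2] cube 1 by simp
      show "[:- 2, 0, 0, 1:] \<in> candidates"
        using candidate_binomial_cubic[OF p2, of 2 1] by (simp add: cong_def)
    qed
  next
    case 2
    show ?thesis
    proof (rule bexI)
      show "passes s [:- 3, 0, 0, 1:]"
        using passes_binomial_cubic[of 1 3] cube 2 by simp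
      show "[:- 3, 0, 0, 1:] \<in> candidates"
        using candidate_binomial_cubic[OF p3, of 3 1] by (simp add: cong_def)
    qed
  next
    case 3
    show ?thesis
    proof (rule bexI)
      show "passes s [:- 6, 0, 0, 1:]"
        using passes_binomial_cubic[of 1 6] cube 3 by simp
      show "[:- 6, 0, 0, 1:] \<in> candidates"
        using candidate_binomial_cubic[OF p2, of 6 1] m6 by (simp add: cong_def)
    qed
  next
    case 4
    obtain y where y: "padic_Cauchy p y" "(\<lambda>n. y n ^ 3 - 12) \<in> padic_null p"
      using cube 4 by (auto simp: Qp_of_rat_eq_cls is_power_in_Qp_cls_iff Cauchy_const)
    \<comment> \<open>The cubic x^3 - 12 has Mahler measure 12, beyond the bound 8.5. Since 3/2 =
      12/2^3, the cubic 2x^3 - 3 replaces it.\<close>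
    have "is_power_in (Qp p) 3 (Qp_of_rat p (3 / 2))"
      unfolding Qp_of_rat_eq_cls is_power_in_Qp_cls_iff[OF Cauchy_const]
    proof (intro exI conjI)
      show "padic_Cauchy p (\<lambda>n. y n / 2)"
        by (intro Cauchy_intros y)
      show "(\<lambda>n. (y n / 2) ^ 3 - 3 / 2) \<in> padic_null p"
        using null_divide_const[OF y(2), of 8] by (simp add: power_divide diff_divide_distrib)
    qed
    show ?thesis
    proof (rule bexI)
      show "passes s [:- 3, 0, 0, 2:]"
        using passes_binomial_cubic[of 2 3] \<open>is_power_in (Qp p) 3 (Qp_of_rat p (3 / 2))\<close> by simp
      show "[:- 3, 0, 0, 2:] \<in> candidates"
        using candidate_binomial_cubic[OF p2, of 3 2]
        by (simp add: cong_def not_dvd_imp_multiplicity_0)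
    qed
  qed
qed

section \<open>From candidates to heights and back\<close>

lemma mahler_measure_uminus: "mahler_measure (- f) = mahler_measure f"
proof (cases "f = 0")
  case False
  thus ?thesis
    using mahler_measure_dvd[of f "- f"] mahler_measure_dvd[of "- f" f] by simp
qed simp

text \<open>Any complex root of \<open>f\<close> serves: its minimal polynomial is \<open>f\<close>
  or -f, and neither splitting nor Mahler measure depends on the sign.\<close>

lemma passes_imp_height:
  assumes s: "sqrt_choice p s" and f: "f \<in> candidates" "passes s f"
  shows "\<exists>\<alpha>. totally_padic p \<alpha> \<and> alg_degree \<alpha> = 3 \<and> \<alpha> \<noteq> 0 \<and> \<not> root_of_unity \<alpha> \<and>
           weil_height \<alpha> = 1 / 3 * ln (mahler_measure f)"
proof -
  have irr: "irreducible f" and deg: "Polynomial.degree f = 3"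
    using f by (auto simp: candidates_def)
  have "\<not> constant (poly (map_poly complex_of_int f))"
    using deg by (simp add: constant_degree)
  then obtain \<alpha> :: complex where root: "poly (map_poly of_int f) \<alpha> = 0"
    using fundamental_theorem_of_algebra by blast
  define g where "g = (if lead_coeff f > 0 then f else - f)"
  have "f \<noteq> 0"
    using irr by auto
  hence f0: "lead_coeff f \<noteq> 0"
    by simp
  have "irreducible g" "lead_coeff g > 0" "poly (map_poly of_int g) \<alpha> = 0"
    using irr f0 root by (auto simp: g_def hom_distribs)
  hence min: "min_int_poly \<alpha> = g"
    by (rule min_int_poly_eqI)
  have "Polynomial.degree g = 3"
    using deg by (simp add: g_def)
  moreover have "mahler_measure g = mahler_measure f"
    by (simp add: g_def mahler_measure_uminus)
  moreover have "splits_over_Qp p g"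
    using passes_iff_splits[OF s deg] f(2) splits_over_Qp_uminus[OF deg] by (simp add: g_def)
  moreover have "algebraic \<alpha>"
    by (rule algebraicI[of "map_poly of_int f"]) (use root f0 in auto)
  moreover have "\<alpha> \<noteq> 0"
  proof
    assume "\<alpha> = 0"
    hence "poly f 0 = 0"
      using root by (simp add: poly_0_coeff_0)
    thus False
      using irreducible_degree_3_no_int_root[OF irr deg] by blast
  qed
  moreover have "\<not> root_of_unity \<alpha>"
    by (rule cubic_root_not_root_of_unity[OF irr deg root])
  ultimately show ?thesis
    by (intro exI[of _ \<alpha>]) (auto simp: totally_padic_def alg_degree_def weil_height_def min)
qed

lemma totally_padic_imp_passes:
  assumes s: "sqrt_choice p s" and \<alpha>: "totally_padic p \<alpha>" "alg_degree \<alpha> = 3" "\<not> root_of_unity \<alpha>"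
    and M: "mahler_measure (min_int_poly \<alpha>) \<le> 8.5"
  shows "min_int_poly \<alpha> \<in> candidates" "passes s (min_int_poly \<alpha>)"
proof -
  have alg: "algebraic \<alpha>" and splits: "splits_over_Qp p (min_int_poly \<alpha>)" and deg: "Polynomial.degree (min_int_poly \<alpha>) = 3"
    using \<alpha> by (auto simp: totally_padic_def alg_degree_def)
  show "passes s (min_int_poly \<alpha>)"
    using passes_iff_splits[OF s deg] splits by simp
  have "\<not> is_cyclotomic (min_int_poly \<alpha>)"
    using is_cyclotomic_imp_root_of_unity algebraic_imp_irreducible_min_int_poly(3)[OF alg] \<alpha>(3) by blast
  thus "min_int_poly \<alpha> \<in> candidates"
    using algebraic_imp_irreducible_min_int_poly(1)[OF alg] deg M by (simp add: candidates_def)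
qed

lemma cubic_search_eq_tau:
  assumes L: "candidate_list L" and s: "sqrt_choice p s"
  shows "cubic_search p s L = Some (tau 3 p)"
proof -
  have set: "set L = candidates"
    and sorted: "sorted_wrt (\<lambda>f g. mahler_measure f \<le> mahler_measure g) L"
    using L by (auto simp: candidate_list_def)
  obtain f where f: "f \<in> candidates" "passes s f"
    and search: "cubic_search p s L = Some (1 / 3 * ln (mahler_measure f))"
    and least: "\<And>g. g \<in> candidates \<Longrightarrow> passes s g \<Longrightarrow> mahler_measure f \<le> mahler_measure g"
    using cubic_search_eq_first[OF _ sorted] some_candidate_passes unfolding set by metis
  \<comment> \<open>Positivity, so that comparing Mahler measures compares their logarithms.\<close>
  have f0: "mahler_measure f \<ge> 1"
    using f(1) by (intro mahler_measure_poly_ge_1) (auto simp: candidates_def)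
  have "tau 3 p = 1 / 3 * ln (mahler_measure f)"
    unfolding tau_def
  proof (rule Least_equality)
    show "1 / 3 * ln (mahler_measure f) \<in> {weil_height \<alpha> | \<alpha>. totally_padic p \<alpha> \<and> alg_degree \<alpha> = 3 \<and> \<alpha> \<noteq> 0 \<and> \<not> root_of_unity \<alpha>}"
      using passes_imp_height[OF s f] by force
    fix h assume "h \<in> {weil_height \<alpha> | \<alpha>. totally_padic p \<alpha> \<and> alg_degree \<alpha> = 3 \<and> \<alpha> \<noteq> 0 \<and> \<not> root_of_unity \<alpha>}"
    then obtain \<alpha> where \<alpha>: "totally_padic p \<alpha>" "alg_degree \<alpha> = 3" "\<not> root_of_unity \<alpha>" and h: "h = weil_height \<alpha>"
      by blast
    have "mahler_measure f \<le> mahler_measure (min_int_poly \<alpha>)"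
    \<comment> \<open>Numbers beyond the bound 8.5 are not represented in the list, but their Mahler
      measure exceeds that of \<open>f\<close> anyway.\<close>
    proof (cases "mahler_measure (min_int_poly \<alpha>) \<le> 8.5")
      case True
      thus ?thesis
        using totally_padic_imp_passes[OF s \<alpha>] least by blast
    next
      case False
      thus ?thesis
        using f(1) by (simp add: candidates_def)
    qed
    thus "1 / 3 * ln (mahler_measure f) \<le> h"
      using \<alpha>(2) f0 by (simp add: h weil_height_def)
  qed
  thus ?thesis
    using search by simp
qed

end

theorem theorem7:
  fixes p :: nat
  assumes "prime p" and "[p = 1] (mod 3)"
  shows "(\<exists>L. candidate_list L) \<and>
         (\<forall>L s. candidate_list L \<and> sqrt_choice p s \<longrightarrow> cubic_search p s L = Some (tau 3 p))"
proof -
  interpret padic_1_mod_3 p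
    using assms by unfold_locales
  show ?thesis
    using candidate_list_exists cubic_search_eq_tau by blast
qed

end
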